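(* Let $G$ be an infinite countable residually finite amenable group with a Følner sequence $\lambda=\{F_n\}$, and let $\phi(n)$ be a function with $\lim_n\phi(n)=\infty$. Then the set of all p.m.p. actions $\alpha\in A(G,X,\mu)$ satisfying $\mathcal{H}(\alpha,\lambda)\succ\phi$ is meager in $A(G,X,\mu)$.
   Context: $(X,\mu)$ is a Lebesgue space (standard non-atomic probability space). $\mathrm{Aut}(X,\mu)$ is the group of invertible measure-preserving transformations of $(X,\mu)$ with the weak topology (Polish). $A(G,X,\mu)$ is the set of p.m.p. actions of $G$ on $(X,\mu)$, i.e. homomorphisms $G\to\mathrm{Aut}(X,\mu)$, a closed (hence Polish) subspace of $\mathrm{Aut}(X,\mu)^G$ with the product topology. A subset of $A(G,X,\mu)$ is meager if its complement contains a dense $G_\delta$ subset. A Følner sequence is a sequence of finite non-empty sets $F_n\subset G$ with $|gF_n\triangle F_n|/|F_n|\to0$ for every $g\in G$. Scaling entropy. A measurable semimetric on $(X,\mu)$ is a measurable function $\rho:(X^2,\mu^2)\to[0,\infty)$ that is symmetric and satisfies the triangle inequality. For $\varepsilon>0$, $\mathbb{H}_\varepsilon(X,\mu,\rho)=\log_2 k$, where $k$ is the minimal positive integer such that $X$ is a union of measurable sets $X_0,X_1,\dots,X_k$ with $\mu(X_0)<\varepsilon$ and $\mathrm{diam}_\rho(X_i)<\varepsilon$ for $i=1,\dots,k$ (and $\mathbb{H}_\varepsilon=+\infty$ if no such $k$ exists). $\rho$ is admissible if it is separable on some subset of full measure (equivalently $\mathbb{H}_\varepsilon(X,\mu,\rho)<\infty$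 for all $\varepsilon>0$). $\mathcal{A}dm(X,\mu)$ is the set of admissible semimetrics in $L^1(X^2,\mu^2)$. Given an action $\alpha$ of $G$, $\rho$ is generating if its translates $(x,y)\mapsto\rho(gx,gy)$, $g\in G$, together separate points of $X$ up to a null set. Put $G^n_{av}\rho(x,y)=\frac1{|F_n|}\sum_{g\in F_n}\rho(gx,gy)$ and $\Phi_\rho(n,\varepsilon)=\mathbb{H}_\varepsilon(X,\mu,G^n_{av}\rho)$. For sequences, $\phi\precsim\psi$ means $\phi(n)=O(\psi(n))$ and $\phi\prec\psi$ means $\phi(n)=o(\psi(n))$. For functions $\Phi,\Psi:\mathbb{N}\times\mathbb{R}_+\to\mathbb{R}_+$ decreasing (non-strictly) in the second argument: $\Phi\precsim\Psi$ means that for every $\varepsilon>0$ there is $\delta>0$ with $\Phi(n,\varepsilon)\precsim\Psi(n,\delta)$; $\Phi\asymp\Psi$ means $\Phi\precsim\Psi$ and $\Psi\precsim\Phi$; $\Phi\prec\Psi$ (also written $\Psi\succ\Phi$) means that there is $\delta>0$ such that for every $\varepsilon>0$ one has $\Phi(n,\varepsilon)\prec\Psi(n,\delta)$. These relations respect $\asymp$. A sequence $\phi(n)$ is regarded as a function of $(n,\varepsilon)$ not depending on $\varepsilon$; thus $\Psi\succ\phi$ means that $\phi(n)=o(\Psi(n,\delta))$ for some $\delta>0$. The scaling entropy $\mathcal{H}(\alpha,\lambda)$ is the $\asymp$-equivalence class of $\Phi_\rho$ for any generating $\rho\in\mathcal{A}dm(X,\mu)$; by a theorem of Zatitskiy it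 does not depend on the choice of $\rho$. $\mathcal{H}(\alpha,\lambda)\succ\phi$ means $\Phi\succ\phi$ for (one, equivalently every) $\Phi\in\mathcal{H}(\alpha,\lambda)$. *)

theory Defs
  imports
    "HOL-Probability.Probability"
    "HOL-Algebra.Coset"
    "HOL-Library.Landau_Symbols"
begin

section \<open>Groups\<close>

definition residually_finite :: "('g, 'r) monoid_scheme \<Rightarrow> bool" where
  "residually_finite G \<longleftrightarrow>
     (\<forall>g\<in>carrier G. g \<noteq> \<one>\<^bsub>G\<^esub> \<longrightarrow> (\<exists>N. N \<lhd> G \<and> finite (rcosets\<^bsub>G\<^esub> N) \<and> g \<notin> N))"

definition folner_sequence :: "('g, 'r) monoid_scheme \<Rightarrow> (nat \<Rightarrow> 'g set) \<Rightarrow> bool" where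
  "folner_sequence G F \<longleftrightarrow>
     (\<forall>n. F n \<subseteq> carrier G \<and> finite (F n) \<and> F n \<noteq> {}) \<and>
     (\<forall>g\<in>carrier G.
        (\<lambda>n. real (card (sym_diff (g <#\<^bsub>G\<^esub> F n) (F n))) / real (card (F n))) \<longlonglongrightarrow> 0)"

definition amenable :: "('g, 'r) monoid_scheme \<Rightarrow> bool" where
  "amenable G \<longleftrightarrow> (\<exists>F. folner_sequence G F)"


section \<open>Lebesgue spaces and their automorphism groups\<close>

definition non_atomic :: "'a measure \<Rightarrow> bool" where
  "non_atomic M \<longleftrightarrow>
     (\<forall>A\<in>sets M. 0 < emeasure M A \<longrightarrow>
        (\<exists>B\<in>sets M. B \<subseteq> A \<and> 0 < emeasure M B \<and> emeasure M B < emeasure M A))"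

text \<open>
  The sigma-algebra is that of the Borel sets, not its completion. Passing to the completion
  changes neither the automorphism group (its elements are classes modulo null sets) nor the
  epsilon-entropies below.
\<close>

definition lebesgue_space :: "'a::polish_space measure \<Rightarrow> bool" where
  "lebesgue_space M \<longleftrightarrow> prob_space M \<and> sets M = sets borel \<and> non_atomic M"

definition measure_preserving :: "'a measure \<Rightarrow> ('a \<Rightarrow> 'a) \<Rightarrow> bool" where
  "measure_preserving M T \<longleftrightarrow> T \<in> M \<rightarrow>\<^sub>M M \<and> distr M M T = M"

text \<open>Invertibility is understood modulo null sets.\<close>

definition invertible_mpt :: "'a measure \<Rightarrow> ('a \<Rightarrow> 'a) set" where
  "invertible_mpt M =
     {T. measure_preserving M T \<and>
         (\<exists>S. measure_preserving M S \<and> (AE x in M. S (T x) = x) \<and> (AE x in M. T (S x) = x))}"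

definition ae_equal :: "'a measure \<Rightarrow> (('a \<Rightarrow> 'a) \<times> ('a \<Rightarrow> 'a)) set" where
  "ae_equal M = {(S, T). S \<in> invertible_mpt M \<and> T \<in> invertible_mpt M \<and> (AE x in M. S x = T x)}"

definition Aut :: "'a measure \<Rightarrow> ('a \<Rightarrow> 'a) set monoid" where
  "Aut M =
     \<lparr>carrier = invertible_mpt M // ae_equal M,
      mult = (\<lambda>c d. \<Union>S\<in>c. \<Union>T\<in>d. ae_equal M `` {S \<circ> T}),
      one = ae_equal M `` {id}\<rparr>"

text \<open>
  The weak topology is the coarsest one making all maps \<open>T \<mapsto> T A\<close> into the measure algebra (with
  the distance of two sets being the measure of their symmetric difference) continuous. Writing
  preimages instead of images gives the same topology: if \<open>B\<close> is the preimage of \<open>A\<close> under \<open>S\<close>,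
  then the symmetric difference of the preimages of \<open>A\<close> under \<open>T\<close> and \<open>S\<close> has the same measure
  as that of the images of \<open>B\<close> under \<open>T\<close> and \<open>S\<close>.
\<close>

definition weak_topology :: "'a measure \<Rightarrow> ('a \<Rightarrow> 'a) set topology" where
  "weak_topology M = topology_generated_by
     {{c \<in> carrier (Aut M).
         \<exists>T\<in>c. measure M (sym_diff (T -` A \<inter> space M) (S -` A \<inter> space M)) < e} | S A e.
       S \<in> invertible_mpt M \<and> A \<in> sets M \<and> (0::real) < e}"

definition actions :: "('g, 'r) monoid_scheme \<Rightarrow> 'a measure \<Rightarrow> ('g \<Rightarrow> ('a \<Rightarrow> 'a) set) set" where
  "actions G M = hom G (Aut M) \<inter> extensional (carrier G)"

definition action_topology ::
    "('g, 'r) monoid_scheme \<Rightarrow> 'a measure \<Rightarrow> ('g \<Rightarrow> ('a \<Rightarrow> 'a) set) topology" where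
  "action_topology G M =
     subtopology (product_topology (\<lambda>_. weak_topology M) (carrier G)) (actions G M)"

definition meager_in :: "'b topology \<Rightarrow> 'b set \<Rightarrow> bool" where
  "meager_in X S \<longleftrightarrow>
     S \<subseteq> topspace X \<and>
     (\<exists>D. gdelta_in X D \<and> X closure_of D = topspace X \<and> D \<subseteq> topspace X - S)"


section \<open>Semimetrics and epsilon-entropy\<close>

text \<open>
  Vanishing on the diagonal is not required here; for admissible semimetrics it
  follows on a set of full measure.
\<close>

definition measurable_semimetric :: "'a measure \<Rightarrow> ('a \<Rightarrow> 'a \<Rightarrow> real) \<Rightarrow> bool" where
  "measurable_semimetric M \<rho> \<longleftrightarrow>
     (\<lambda>(x, y). \<rho> x y) \<in> borel_measurable (M \<Otimes>\<^sub>M M) \<and>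
     (\<forall>x\<in>space M. \<forall>y\<in>space M. 0 \<le> \<rho> x y \<and> \<rho> x y = \<rho> y x) \<and>
     (\<forall>x\<in>space M. \<forall>y\<in>space M. \<forall>z\<in>space M. \<rho> x z \<le> \<rho> x y + \<rho> y z)"

definition diam :: "('a \<Rightarrow> 'a \<Rightarrow> real) \<Rightarrow> 'a set \<Rightarrow> ennreal" where
  "diam \<rho> A = (SUP (x, y)\<in>A \<times> A. ennreal (\<rho> x y))"

definition eps_cover :: "'a measure \<Rightarrow> ('a \<Rightarrow> 'a \<Rightarrow> real) \<Rightarrow> real \<Rightarrow> nat \<Rightarrow> bool" where
  "eps_cover M \<rho> \<epsilon> k \<longleftrightarrow>
     (\<exists>A :: nat \<Rightarrow> 'a set.
        (\<forall>i\<le>k. A i \<in> sets M) \<and> space M = (\<Union>i\<le>k. A i) \<and>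
        measure M (A 0) < \<epsilon> \<and> (\<forall>i\<in>{1..k}. diam \<rho> (A i) < ennreal \<epsilon>))"

definition eps_entropy :: "'a measure \<Rightarrow> ('a \<Rightarrow> 'a \<Rightarrow> real) \<Rightarrow> real \<Rightarrow> ereal" where
  "eps_entropy M \<rho> \<epsilon> =
     (if \<exists>k>0. eps_cover M \<rho> \<epsilon> k
      then ereal (log 2 (real (LEAST k. k > 0 \<and> eps_cover M \<rho> \<epsilon> k))) else \<infinity>)"

definition admissible :: "'a measure \<Rightarrow> ('a \<Rightarrow> 'a \<Rightarrow> real) \<Rightarrow> bool" where
  "admissible M \<rho> \<longleftrightarrow>
     measurable_semimetric M \<rho> \<and>
     (\<exists>Y\<in>sets M. measure M Y = 1 \<and>
        (\<exists>D. countable D \<and> D \<subseteq> Y \<and> (\<forall>x\<in>Y. \<forall>e>0. \<exists>d\<in>D. \<rho> x d < e)))"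

definition Adm :: "'a measure \<Rightarrow> ('a \<Rightarrow> 'a \<Rightarrow> real) set" where
  "Adm M = {\<rho>. admissible M \<rho> \<and> integrable (M \<Otimes>\<^sub>M M) (\<lambda>(x, y). \<rho> x y)}"


section \<open>Scaling entropy\<close>

text \<open>
  A representative of the class \<open>\<alpha> g\<close>. Another choice changes the maps on null sets only, which
  affects neither the property of being generating (for countable groups) nor any epsilon-entropy.
\<close>

definition act :: "('g \<Rightarrow> ('a \<Rightarrow> 'a) set) \<Rightarrow> 'g \<Rightarrow> 'a \<Rightarrow> 'a" where
  "act \<alpha> g = (SOME T. T \<in> \<alpha> g)"

definition generating ::
    "('g, 'r) monoid_scheme \<Rightarrow> 'a measure \<Rightarrow> ('g \<Rightarrow> ('a \<Rightarrow> 'a) set) \<Rightarrow> ('a \<Rightarrow> 'a \<Rightarrow> real) \<Rightarrow> bool" where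
  "generating G M \<alpha> \<rho> \<longleftrightarrow>
     (\<exists>Y\<in>sets M. measure M Y = 1 \<and>
        (\<forall>x\<in>Y. \<forall>y\<in>Y. x \<noteq> y \<longrightarrow> (\<exists>g\<in>carrier G. 0 < \<rho> (act \<alpha> g x) (act \<alpha> g y))))"

definition average ::
    "('g \<Rightarrow> ('a \<Rightarrow> 'a) set) \<Rightarrow> 'g set \<Rightarrow> ('a \<Rightarrow> 'a \<Rightarrow> real) \<Rightarrow> 'a \<Rightarrow> 'a \<Rightarrow> real" where
  "average \<alpha> E \<rho> x y = (\<Sum>g\<in>E. \<rho> (act \<alpha> g x) (act \<alpha> g y)) / real (card E)"

text \<open>The entropy below is finite for admissible \<open>\<rho>\<close>, so \<^const>\<open>real_of_ereal\<close> loses nothing.\<close>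

definition Phi ::
    "'a measure \<Rightarrow> ('g \<Rightarrow> ('a \<Rightarrow> 'a) set) \<Rightarrow> (nat \<Rightarrow> 'g set) \<Rightarrow> ('a \<Rightarrow> 'a \<Rightarrow> real) \<Rightarrow>
     nat \<Rightarrow> real \<Rightarrow> real" where
  "Phi M \<alpha> F \<rho> n \<epsilon> = real_of_ereal (eps_entropy M (average \<alpha> (F n) \<rho>) \<epsilon>)"

definition scaling_function :: "(nat \<Rightarrow> real \<Rightarrow> real) \<Rightarrow> bool" where
  "scaling_function \<Phi> \<longleftrightarrow>
     (\<forall>n. (\<forall>\<epsilon>>0. 0 \<le> \<Phi> n \<epsilon>) \<and> antimono_on {0<..} (\<Phi> n))"

definition scaling_le :: "(nat \<Rightarrow> real \<Rightarrow> real) \<Rightarrow> (nat \<Rightarrow> real \<Rightarrow> real) \<Rightarrow> bool" where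
  "scaling_le \<Phi> \<Psi> \<longleftrightarrow> (\<forall>\<epsilon>>0. \<exists>\<delta>>0. (\<lambda>n. \<Phi> n \<epsilon>) \<in> O(\<lambda>n. \<Psi> n \<delta>))"

definition scaling_equiv :: "(nat \<Rightarrow> real \<Rightarrow> real) \<Rightarrow> (nat \<Rightarrow> real \<Rightarrow> real) \<Rightarrow> bool" where
  "scaling_equiv \<Phi> \<Psi> \<longleftrightarrow> scaling_le \<Phi> \<Psi> \<and> scaling_le \<Psi> \<Phi>"

definition scaling_less :: "(nat \<Rightarrow> real \<Rightarrow> real) \<Rightarrow> (nat \<Rightarrow> real \<Rightarrow> real) \<Rightarrow> bool" where
  "scaling_less \<Phi> \<Psi> \<longleftrightarrow> (\<exists>\<delta>>0. \<forall>\<epsilon>>0. (\<lambda>n. \<Phi> n \<epsilon>) \<in> o(\<lambda>n. \<Psi> n \<delta>))"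

text \<open>
  By Zatitskiy's theorem all generating \<open>\<rho> \<in> Adm M\<close> give the same equivalence class. The
  definition is the union of these classes, so it does not presuppose that theorem.
\<close>

definition scaling_entropy ::
    "('g, 'r) monoid_scheme \<Rightarrow> 'a measure \<Rightarrow> (nat \<Rightarrow> 'g set) \<Rightarrow> ('g \<Rightarrow> ('a \<Rightarrow> 'a) set) \<Rightarrow>
     (nat \<Rightarrow> real \<Rightarrow> real) set" where
  "scaling_entropy G M F \<alpha> =
     {\<Psi>. scaling_function \<Psi> \<and>
         (\<exists>\<rho>\<in>Adm M. generating G M \<alpha> \<rho> \<and> scaling_equiv (Phi M \<alpha> F \<rho>) \<Psi>)}"

definition entropy_exceeds ::
    "('g, 'r) monoid_scheme \<Rightarrow> 'a measure \<Rightarrow> (nat \<Rightarrow> 'g set) \<Rightarrow> ('g \<Rightarrow> ('a \<Rightarrow> 'a) set) \<Rightarrow>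
     (nat \<Rightarrow> real) \<Rightarrow> bool" where
  "entropy_exceeds G M F \<alpha> \<phi> \<longleftrightarrow>
     (\<exists>\<Phi>\<in>scaling_entropy G M F \<alpha>. scaling_less (\<lambda>n _. \<phi> n) \<Phi>)"

end

theory Submission
  imports Defs
begin

text \<open>
  Actions with finite image have bounded scaling entropy: for a finite partition of \<open>X\<close>, the finitely
  many maps through which \<open>G\<close> acts generate one finite partition into sets on which all averages
  vanish. For fixed \<open>n\<close> a partition with few cells that works up to a small set survives small
  perturbations of the action in the weak topology, so every action with finite image has neighbourhoods on
  which the entropy at some arbitrarily late \<open>n\<close> is at most \<open>\<phi> n\<close>. Intersecting unions of such
  neighbourhoods yields a \<open>G\<^sub>\<delta>\<close> set that avoids the actions in question and contains all actions with
  finite image. So it remains to see that the latter are dense; no Baire category argument is needed.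

  To approximate \<open>\<alpha>\<close>, let \<open>G\<close> act on the finite set \<open>\<Omega>\<close> of rankings of a finite quotient
  of \<open>G\<close> in which a Folner set \<open>F\<close> embeds, and let \<open>f v\<close> be the element of \<open>F\<close> ranked highest
  by \<open>v\<close>. Then \<open>f (g v) = g (f v)\<close> for most \<open>v\<close>. Hence the measure preserving map
  \<open>(v, x) \<mapsto> \<alpha> (f v) x\<close> from \<open>\<Omega> \<times> X\<close> to \<open>X\<close> almost intertwines the action of \<open>G\<close> on the
  first factor with \<open>\<alpha>\<close>, and this action on \<open>\<Omega> \<times> X\<close> is transported to \<open>X\<close> by an isomorphism
  under which the map respects any prescribed finite family of sets.
\<close>

section \<open>Almost equivariant maps from finite sets\<close>

definition rankings :: "'q set \<Rightarrow> ('q \<Rightarrow> nat) set" where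
  "rankings Q = {v \<in> extensional Q. bij_betw v Q {..<card Q}}"

lemma finite_rankings: "finite Q \<Longrightarrow> finite (rankings Q)"
  by (rule finite_subset[OF _ finite_PiE[of Q "\<lambda>_. {..<card Q}"]])
     (auto simp: rankings_def PiE_def bij_betw_def)

lemma rankings_nonempty:
  assumes "finite Q"
  shows "rankings Q \<noteq> {}"
proof -
  obtain v where "bij_betw v Q {0..<card Q}"
    using ex_bij_betw_finite_nat[OF assms] by blast
  then have "restrict v Q \<in> rankings Q"
    by (simp add: rankings_def atLeast0LessThan)
  then show ?thesis by blast
qed

lemma rankings_comp:
  assumes "v \<in> rankings Q" "bij_betw s Q Q"
  shows "(\<lambda>q\<in>Q. v (s q)) \<in> rankings Q"
  using bij_betw_trans[OF assms(2), of v] assms(1) by (simp add: rankings_def comp_def)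

text \<open>Swapping \<open>u\<close> and \<open>w\<close> permutes both \<open>Q\<close> and
  \<open>U\<close>, so precomposition with this transposition sends rankings with \<open>u\<close>
  on top of \<open>U\<close> injectively to rankings with \<open>w\<close> on top.\<close>

lemma card_rankings_top_eq:
  assumes "finite Q" "U \<subseteq> Q" "u \<in> U" "w \<in> U"
  shows "card {v \<in> rankings Q. \<forall>q\<in>U. v q \<le> v u} \<le> card {v \<in> rankings Q. \<forall>q\<in>U. v q \<le> v w}"
proof (rule card_inj_on_le)
  define t where "t = Transposition.transpose u w"
  have tQ: "bij_betw t Q Q" and tU: "\<And>q. q \<in> U \<Longrightarrow> t q \<in> U" and tt: "\<And>q. t (t q) = q"
    and tu: "t w = u"
    using assms by (auto simp: t_def Transposition.transpose_def
        intro!: bij_betw_byWitness[where f' = "Transposition.transpose u w"])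
  have tQ': "t q \<in> Q" if "q \<in> Q" for q using tQ that by (auto simp: bij_betw_def)
  show "inj_on (\<lambda>v. \<lambda>q\<in>Q. v (t q)) {v \<in> rankings Q. \<forall>q\<in>U. v q \<le> v u}"
  proof (rule inj_onI)
    fix v v' assume v: "v \<in> {v \<in> rankings Q. \<forall>q\<in>U. v q \<le> v u}"
      "v' \<in> {v \<in> rankings Q. \<forall>q\<in>U. v q \<le> v u}"
      and eq: "(\<lambda>q\<in>Q. v (t q)) = (\<lambda>q\<in>Q. v' (t q))"
    show "v = v'"
    proof (rule extensionalityI[of _ Q])
      fix q assume "q \<in> Q"
      with fun_cong[OF eq, of "t q"] show "v q = v' q" by (simp add: tQ' tt)
    qed (use v in \<open>auto simp: rankings_def\<close>)
  qed
  show "(\<lambda>v. \<lambda>q\<in>Q. v (t q)) ` {v \<in> rankings Q. \<forall>q\<in>U. v q \<le> v u}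
        \<subseteq> {v \<in> rankings Q. \<forall>q\<in>U. v q \<le> v w}"
    using assms tU by (auto intro!: rankings_comp tQ simp: subset_iff tu)
  show "finite {v \<in> rankings Q. \<forall>q\<in>U. v q \<le> v w}"
    by (simp add: finite_rankings assms)
qed

lemma ranking_top_ex1:
  assumes "v \<in> rankings Q" "finite U" "U \<noteq> {}" "U \<subseteq> Q"
  shows "\<exists>!u. u \<in> U \<and> (\<forall>q\<in>U. v q \<le> v u)"
proof -
  have inj: "inj_on v U"
    using assms inj_on_subset by (auto simp: rankings_def bij_betw_def)
  have "Max (v ` U) \<in> v ` U" using assms by (intro Max_in) auto
  then obtain u where "u \<in> U" "v u = Max (v ` U)" by auto
  then have u: "u \<in> U \<and> (\<forall>q\<in>U. v q \<le> v u)" using assms(2) by simp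
  show ?thesis
  proof (rule ex1I, rule u)
    fix w assume w: "w \<in> U \<and> (\<forall>q\<in>U. v q \<le> v w)"
    then have "v w = v u" using u by (simp add: le_antisym)
    then show "w = u" using inj_onD[OF inj] w u by blast
  qed
qed

text \<open>By symmetry the top-ranked element of \<open>U\<close> is uniformly distributed on \<open>U\<close>.\<close>

lemma card_rankings_top:
  assumes "finite Q" "U \<subseteq> Q" "W \<subseteq> U"
  shows "card {v \<in> rankings Q. \<exists>u\<in>W. \<forall>q\<in>U. v q \<le> v u} * card U = card W * card (rankings Q)"
proof (cases "W = {}")
  case False
  define R where "R u = {v \<in> rankings Q. \<forall>q\<in>U. v q \<le> v u}" for u
  have fU: "finite U" by (rule finite_subset[OF assms(2,1)])
  have fR: "finite (R u)" for u by (simp add: R_def finite_rankings assms)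
  obtain w where w: "w \<in> W" using False by (auto simp: ex_in_conv[symmetric])
  have eq: "card (R u) = card (R w)" if "u \<in> U" for u
    using card_rankings_top_eq[OF assms(1,2), of u w] card_rankings_top_eq[OF assms(1,2), of w u]
      that w assms(3) by (auto simp: R_def)
  have ex1: "\<exists>!u. u \<in> U \<and> (\<forall>q\<in>U. v q \<le> v u)" if "v \<in> rankings Q" for v
    using w assms by (intro ranking_top_ex1[OF that fU]) auto
  have dis: "R u \<inter> R u' = {}" if "u \<in> U" "u' \<in> U" "u \<noteq> u'" for u u'
    using ex1 that by (auto simp: R_def)
  have sumW: "card (\<Union>u\<in>T. R u) = card T * card (R w)" if "T \<subseteq> U" for T
  proof -
    have "card (\<Union>u\<in>T. R u) = (\<Sum>u\<in>T. card (R u))"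
      using finite_subset[OF that fU] that by (intro card_UN_disjoint) (auto simp: fR subset_iff dis)
    also have "\<dots> = (\<Sum>u\<in>T. card (R w))" using that by (intro sum.cong refl eq) auto
    finally show ?thesis by simp
  qed
  have "rankings Q = (\<Union>u\<in>U. R u)"
    using ex1 by (auto simp: R_def dest!: ex1_implies_ex)
  then have "card (rankings Q) = card U * card (R w)" using sumW[of U] by simp
  moreover have "{v \<in> rankings Q. \<exists>u\<in>W. \<forall>q\<in>U. v q \<le> v u} = (\<Union>u\<in>W. R u)"
    by (auto simp: R_def)
  ultimately show ?thesis using sumW[OF assms(3)] by simp
qed simp

section \<open>Finite quotients and almost equivariance\<close>

text \<open>For distinct \<open>x\<close> and \<open>y\<close> in \<open>E\<close>, some normal
  subgroup of finite index misses \<open>inv x \<otimes> y\<close>. Recording the cosets for all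
  these subgroups at once gives the quotient map by their intersection without forming that
  intersection. The last clause lets left multiplication descend to the image of
  \<open>\<kappa>\<close>.\<close>

lemma residually_finite_separates:
  fixes G (structure)
  assumes "group G" "residually_finite G" "finite E" "E \<subseteq> carrier G"
  obtains \<kappa> :: "'g \<Rightarrow> 'g \<Rightarrow> 'g set" where "finite (\<kappa> ` carrier G)" "inj_on \<kappa> E"
    "\<And>g x y. g \<in> carrier G \<Longrightarrow> x \<in> carrier G \<Longrightarrow> y \<in> carrier G \<Longrightarrow> \<kappa> x = \<kappa> y \<Longrightarrow>
       \<kappa> (g \<otimes> x) = \<kappa> (g \<otimes> y)"
proof -
  interpret group G by fact
  define D where "D = (\<lambda>(x, y). inv x \<otimes> y) ` {(x, y). x \<in> E \<and> y \<in> E \<and> x \<noteq> y}"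
  have finD: "finite D"
    unfolding D_def by (rule finite_imageI, rule finite_subset[of _ "E \<times> E"]) (use assms(3) in auto)
  have "\<forall>d\<in>D. \<exists>N. N \<lhd> G \<and> finite (rcosets N) \<and> d \<notin> N"
  proof
    fix d assume "d \<in> D"
    then obtain x y where xy: "x \<in> E" "y \<in> E" "x \<noteq> y" "d = inv x \<otimes> y" by (auto simp: D_def)
    then have c: "x \<in> carrier G" "y \<in> carrier G" using assms(4) by auto
    have "d \<noteq> \<one>" using xy c by (metis inv_equality inv_inv inv_closed)
    then show "\<exists>N. N \<lhd> G \<and> finite (rcosets N) \<and> d \<notin> N"
      using assms(2) xy c unfolding residually_finite_def by auto
  qed
  then obtain N where N: "\<And>d. d \<in> D \<Longrightarrow> N d \<lhd> G" "\<And>d. d \<in> D \<Longrightarrow> finite (rcosets (N d))"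
      "\<And>d. d \<in> D \<Longrightarrow> d \<notin> N d" by metis
  define \<kappa> where "\<kappa> x = (\<lambda>d\<in>D. N d #> x)" for x
  have "finite (\<kappa> ` carrier G)"
  proof (rule finite_subset)
    show "\<kappa> ` carrier G \<subseteq> (\<Pi>\<^sub>E d\<in>D. rcosets (N d))"
      by (auto simp: \<kappa>_def RCOSETS_def)
    show "finite (\<Pi>\<^sub>E d\<in>D. rcosets (N d))" by (intro finite_PiE finD N)
  qed
  moreover have "inj_on \<kappa> E"
  proof (rule inj_onI, rule ccontr)
    fix x y assume xy: "x \<in> E" "y \<in> E" "\<kappa> x = \<kappa> y" "x \<noteq> y"
    then have c: "x \<in> carrier G" "y \<in> carrier G" using assms(4) by auto
    have d: "inv x \<otimes> y \<in> D" using xy by (auto simp: D_def)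
    let ?N = "N (inv x \<otimes> y)"
    interpret nrm: normal ?N G by (rule N(1)[OF d])
    have "?N #> x = ?N #> y" using fun_cong[OF xy(3), of "inv x \<otimes> y"] d by (simp add: \<kappa>_def)
    then have "y \<in> ?N #> x" using rcos_self[OF c(2) nrm.is_subgroup] by simp
    then obtain k where k: "k \<in> ?N" "y = k \<otimes> x" by (auto simp: r_coset_def)
    then have "inv x \<otimes> y = inv x \<otimes> k \<otimes> x" using c nrm.mem_carrier by (simp add: m_assoc)
    also have "\<dots> \<in> ?N" using nrm.inv_op_closed1 c k by simp
    finally show False using N(3)[OF d] by simp
  qed
  moreover have "\<kappa> (g \<otimes> x) = \<kappa> (g \<otimes> y)"
    if gxy: "g \<in> carrier G" "x \<in> carrier G" "y \<in> carrier G" "\<kappa> x = \<kappa> y" for g x y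
  proof -
    have "N d #> (g \<otimes> x) = N d #> (g \<otimes> y)" if d: "d \<in> D" for d
    proof -
      interpret nrm: normal "N d" G by (rule N(1)[OF d])
      \<comment> \<open>Normality turns the right coset of \<open>g\<close> into a left coset, so
        \<open>g\<close> can be pulled out on the left.\<close>
      have "N d #> (g \<otimes> z) = g <# (N d #> z)" if "z \<in> carrier G" for z
      proof -
        have "N d #> (g \<otimes> z) = (N d #> g) #> z"
          using that gxy nrm.subset by (simp add: coset_mult_assoc)
        also have "\<dots> = (g <# N d) #> z" using nrm.coset_eq gxy by simp
        also have "\<dots> = g <# (N d #> z)" using that gxy nrm.subset by (simp add: coset_assoc)
        finally show ?thesis .
      qed
      moreover have "N d #> x = N d #> y" using fun_cong[OF gxy(4), of d] d by (simp add: \<kappa>_def)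
      ultimately show ?thesis using gxy by simp
    qed
    then show ?thesis by (auto simp: \<kappa>_def intro!: restrict_ext)
  qed
  ultimately show ?thesis by (rule that)
qed

text \<open>
  The elements of \<open>\<Omega>\<close> are rankings of a finite quotient of \<open>G\<close>, and \<open>f v\<close> is the element of \<open>F\<close>
  ranked highest by \<open>v\<close>. Since \<open>f (\<tau> g v)\<close> is \<open>g\<close> times the element of \<open>g\<^sup>-\<^sup>1 F\<close> ranked
  highest by \<open>v\<close>, equivariance can fail only if the top of \<open>F \<union> g\<^sup>-\<^sup>1 F\<close> is outside the intersection.
\<close>

lemma almost_equivariant_map:
  fixes G (structure) and F :: "'g set"
  assumes "group G" "residually_finite G" "finite F" "F \<noteq> {}" "F \<subseteq> carrier G"
    "finite S" "S \<subseteq> carrier G"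
  obtains \<Omega> :: "(('g \<Rightarrow> 'g set) \<Rightarrow> nat) set" and \<tau> f where
    "finite \<Omega>" "\<Omega> \<noteq> {}"
    "\<forall>g\<in>carrier G. bij_betw (\<tau> g) \<Omega> \<Omega>"
    "\<forall>g\<in>carrier G. \<forall>h\<in>carrier G. \<forall>v\<in>\<Omega>. \<tau> (g \<otimes> h) v = \<tau> g (\<tau> h v)"
    "\<forall>v\<in>\<Omega>. f v \<in> F"
    "\<forall>g\<in>S. card {v \<in> \<Omega>. f (\<tau> g v) \<noteq> g \<otimes> f v} * card F
        \<le> card (sym_diff (inv g <#\<^bsub>G\<^esub> F) F) * card \<Omega>"
proof -
  interpret group G by fact
  \<comment> \<open>All points whose ranks will be compared. They must stay distinct in the
    quotient.\<close>
  define E where "E = F \<union> (\<Union>g\<in>S. inv g <#\<^bsub>G\<^esub> F)"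
  have "finite E" "E \<subseteq> carrier G"
    using assms by (auto simp: E_def l_coset_def)
  then obtain \<kappa> :: "'g \<Rightarrow> 'g \<Rightarrow> 'g set" where fin: "finite (\<kappa> ` carrier G)" and inj: "inj_on \<kappa> E"
    and inv: "\<And>g x y. g \<in> carrier G \<Longrightarrow> x \<in> carrier G \<Longrightarrow> y \<in> carrier G \<Longrightarrow> \<kappa> x = \<kappa> y \<Longrightarrow>
       \<kappa> (g \<otimes> x) = \<kappa> (g \<otimes> y)"
    using residually_finite_separates[OF assms(1,2)] by metis
  define Q where "Q = \<kappa> ` carrier G"
  define r where "r q = (SOME x. x \<in> carrier G \<and> \<kappa> x = q)" for q
  define a where "a g q = \<kappa> (g \<otimes> r q)" for g q
  have r: "r q \<in> carrier G \<and> \<kappa> (r q) = q" if "q \<in> Q" for q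
    unfolding r_def by (rule someI_ex) (use that in \<open>auto simp: Q_def\<close>)
  have \<kappa>Q: "\<kappa> x \<in> Q" if "x \<in> carrier G" for x using that by (simp add: Q_def)
  have a\<kappa>: "a g (\<kappa> x) = \<kappa> (g \<otimes> x)" if "g \<in> carrier G" "x \<in> carrier G" for g x
    unfolding a_def using that r[OF \<kappa>Q] by (intro inv) auto
  have aQ: "a g q \<in> Q" if "g \<in> carrier G" "q \<in> Q" for g q
    using that r by (auto simp: a_def Q_def)
  have amult: "a (g \<otimes> h) q = a g (a h q)" if "g \<in> carrier G" "h \<in> carrier G" "q \<in> Q" for g h q
    using that r[OF that(3)] a\<kappa>[of g "h \<otimes> r q"] by (simp add: a_def m_assoc)
  have aone: "a \<one> q = q" if "q \<in> Q" for q using r[OF that] by (simp add: a_def)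
  have abij: "bij_betw (a g) Q Q" if "g \<in> carrier G" for g
    by (rule bij_betw_byWitness[where f' = "a (inv g)"])
       (use that in \<open>auto simp: aQ aone amult[symmetric]\<close>)
  define \<Omega> where "\<Omega> = rankings Q"
  \<comment> \<open>The inverse makes precomposition a left action.\<close>
  define \<tau> where "\<tau> g v = (\<lambda>q\<in>Q. v (a (inv g) q))" for g :: 'g and v :: "('g \<Rightarrow> 'g set) \<Rightarrow> nat"
  \<comment> \<open>The top of \<open>U\<close> is sought among group elements, with ranks read
    through \<open>\<kappa>\<close>. It is unique for nonempty \<open>U\<close> inside
    \<open>E\<close>, because \<open>\<kappa>\<close> is injective there.\<close>
  define T where "T U v h \<longleftrightarrow> h \<in> U \<and> (\<forall>x\<in>U. v (\<kappa> x) \<le> v (\<kappa> h))"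
    for U and v :: "('g \<Rightarrow> 'g set) \<Rightarrow> nat" and h
  define f where "f v = (THE h. T F v h)" for v
  have finQ: "finite Q" using fin by (simp add: Q_def)
  have f\<Omega>: "finite \<Omega>" and ne: "\<Omega> \<noteq> {}" by (simp_all add: \<Omega>_def finite_rankings rankings_nonempty finQ)
  have \<tau>\<Omega>: "\<tau> g v \<in> \<Omega>" if "g \<in> carrier G" "v \<in> \<Omega>" for g v
    using rankings_comp[of v Q "a (inv g)"] abij[of "inv g"] that by (simp add: \<tau>_def \<Omega>_def)
  have \<tau>mult: "\<tau> (g \<otimes> h) v = \<tau> g (\<tau> h v)" if "g \<in> carrier G" "h \<in> carrier G" for g h v
    using that by (auto simp: \<tau>_def inv_mult_group amult aQ intro!: restrict_ext)
  have \<tau>one: "\<tau> \<one> v = v" if "v \<in> \<Omega>" for v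
    by (rule extensionalityI[of _ Q]) (use that in \<open>auto simp: \<tau>_def aone \<Omega>_def rankings_def\<close>)
  have \<tau>bij: "bij_betw (\<tau> g) \<Omega> \<Omega>" if "g \<in> carrier G" for g
    by (rule bij_betw_byWitness[where f' = "\<tau> (inv g)"])
       (use that in \<open>auto simp: \<tau>\<Omega> \<tau>one \<tau>mult[symmetric]\<close>)
  have Tex: "\<exists>!h. T U v h" if "v \<in> \<Omega>" "U \<noteq> {}" "U \<subseteq> E" for U v
  proof -
    have U: "finite (\<kappa> ` U)" "\<kappa> ` U \<noteq> {}" "\<kappa> ` U \<subseteq> Q" "inj_on \<kappa> U"
      using that \<open>finite E\<close> \<open>E \<subseteq> carrier G\<close> finite_subset[of U E] inj_on_subset[OF inj, of U]
      by (auto simp: Q_def)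
    then have "\<exists>!u. u \<in> \<kappa> ` U \<and> (\<forall>q\<in>\<kappa> ` U. v q \<le> v u)"
      using that(1) by (intro ranking_top_ex1[of v Q]) (auto simp: \<Omega>_def)
    then obtain u where u: "u \<in> \<kappa> ` U \<and> (\<forall>q\<in>\<kappa> ` U. v q \<le> v u)"
        and uniq: "\<And>w. w \<in> \<kappa> ` U \<Longrightarrow> (\<forall>q\<in>\<kappa> ` U. v q \<le> v w) \<Longrightarrow> w = u"
      by (elim ex1E) blast
    then obtain h where h: "h \<in> U" "u = \<kappa> h" by blast
    show ?thesis
    proof (rule ex1I)
      show "T U v h" using u h by (auto simp: T_def)
      show "k = h" if k: "T U v k" for k
        using uniq[of "\<kappa> k"] k h U(4) by (auto simp: T_def inj_on_def)
    qed
  qed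
  have fT: "T F v h \<Longrightarrow> f v = h" if "v \<in> \<Omega>" for v h
    unfolding f_def by (rule the1_equality[OF Tex[OF that assms(4)]]) (auto simp: E_def)
  have Tf: "T F v (f v)" if "v \<in> \<Omega>" for v
    unfolding f_def by (rule theI'[OF Tex[OF that assms(4)]]) (auto simp: E_def)
  have bad: "card {v \<in> \<Omega>. f (\<tau> g v) \<noteq> g \<otimes> f v} * card F
        \<le> card (sym_diff (inv g <#\<^bsub>G\<^esub> F) F) * card \<Omega>" if g: "g \<in> S" for g
  proof -
    have gG: "g \<in> carrier G" using g assms by auto
    define H where "H = inv g <#\<^bsub>G\<^esub> F"
    have HE: "H \<subseteq> E" "F \<subseteq> E" using g by (auto simp: H_def E_def)
    have HG: "F \<union> H \<subseteq> carrier G" using HE \<open>E \<subseteq> carrier G\<close> by auto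
    let ?U = "F \<union> H" and ?W = "sym_diff H F"
    let ?B = "{v \<in> \<Omega>. \<exists>u\<in>\<kappa> ` ?W. \<forall>q\<in>\<kappa> ` ?U. v q \<le> v u}"
    have "{v \<in> \<Omega>. f (\<tau> g v) \<noteq> g \<otimes> f v} \<subseteq> ?B"
    proof clarsimp
      fix v assume v: "v \<in> \<Omega>" and neq: "f (\<tau> g v) \<noteq> g \<otimes> f v"
      obtain h where h: "T ?U v h" using Tex[OF v, of ?U] HE assms(4) by blast
      show "\<exists>u\<in>?W. \<forall>q\<in>?U. v (\<kappa> q) \<le> v (\<kappa> u)"
      proof (cases "h \<in> F \<and> h \<in> H")
        case True
        then have hG: "h \<in> carrier G" using HG by auto
        have "f v = h" using True h by (intro fT v) (auto simp: T_def)
        moreover have "f (\<tau> g v) = g \<otimes> h"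
        proof (rule fT[OF \<tau>\<Omega>[OF gG v]])
          have 1: "\<tau> g v (\<kappa> x) = v (\<kappa> (inv g \<otimes> x))" if "x \<in> carrier G" for x
            using that gG by (simp add: \<tau>_def \<kappa>Q a\<kappa>)
          have 2: "inv g \<otimes> x \<in> H" if "x \<in> F" for x using that by (auto simp: H_def l_coset_def)
          have 3: "inv g \<otimes> (g \<otimes> h) = h" using gG hG by (simp add: m_assoc[symmetric])
          obtain y where y: "y \<in> F" "h = inv g \<otimes> y" using True by (auto simp: H_def l_coset_def)
          have "g \<otimes> h = y" using y gG assms(5) by (auto simp: m_assoc[symmetric])
          then have "g \<otimes> h \<in> F" using y by simp
          then show "T F (\<tau> g v) (g \<otimes> h)"
            using h 2 assms(5) by (auto simp: T_def 1 3 subset_iff)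
        qed
        ultimately show ?thesis using neq by simp
      next
        case False
        then show ?thesis using h by (auto simp: T_def)
      qed
    qed
    then have "card {v \<in> \<Omega>. f (\<tau> g v) \<noteq> g \<otimes> f v} \<le> card ?B"
      by (intro card_mono) (auto simp: f\<Omega>)
    \<comment> \<open>The exact count of rankings by their top involves the size of the whole union;
      this bound brings it down to \<open>card F\<close>.\<close>
    moreover have "card F \<le> card (\<kappa> ` ?U)"
    proof -
      have "card (\<kappa> ` ?U) = card ?U"
        by (rule card_image) (use inj HE in \<open>auto intro: inj_on_subset\<close>)
      also have "card F \<le> card ?U"
        using HE \<open>finite E\<close> by (intro card_mono) (auto intro: finite_subset)
      finally show ?thesis .
    qed
    ultimately have "card {v \<in> \<Omega>. f (\<tau> g v) \<noteq> g \<otimes> f v} * card F \<le> card ?B * card (\<kappa> ` ?U)"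
      by (rule mult_mono) auto
    also have "\<dots> = card (\<kappa> ` ?W) * card \<Omega>"
      unfolding \<Omega>_def by (rule card_rankings_top[OF finQ]) (use HG in \<open>auto simp: Q_def\<close>)
    also have "\<dots> \<le> card ?W * card \<Omega>"
      using HE \<open>finite E\<close> by (intro mult_right_mono card_image_le) (auto intro: finite_subset)
    finally show ?thesis by (simp add: H_def)
  qed
  have fF: "f v \<in> F" if "v \<in> \<Omega>" for v
    using Tf[OF that] by (simp add: T_def)
  show ?thesis
    by (rule that[of \<Omega> \<tau> f]) (intro ballI f\<Omega> ne \<tau>bij \<tau>mult fF bad; assumption)+
qed

section \<open>Isomorphism of non-atomic standard probability spaces\<close>

text \<open>Base 3 with digits 0 and 1 only: unlike binary expansions, these values determine their
  digits, and they never exceed 1/2.\<close>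

definition ternary :: "(nat \<Rightarrow> bool) \<Rightarrow> real" where
  "ternary b = (\<Sum>n. of_bool (b n) / 3 ^ Suc n)"

text \<open>Deletes the leading digit of a value of \<open>ternary\<close>. The test against 1/3
  reads that digit, since the later ones contribute at most 1/6.\<close>

definition ternary_shift :: "real \<Rightarrow> real" where
  "ternary_shift t = 3 * t - of_bool (1 / 3 \<le> t)"

definition ternary_digit :: "nat \<Rightarrow> real \<Rightarrow> bool" where
  "ternary_digit n t \<longleftrightarrow> 1 / 3 \<le> (ternary_shift ^^ n) t"

lemma third_sums: "(\<lambda>n. 1 / 3 ^ Suc n :: real) sums (1 / 2)"
  using sums_mult[OF geometric_sums[of "1/3::real"], of "1/3"] by (simp add: power_one_over)

lemma summable_ternary: "summable (\<lambda>n. of_bool (b n) / 3 ^ Suc n :: real)"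
  by (rule summable_comparison_test'[OF sums_summable[OF third_sums], of 0]) auto

lemma ternary_bounds: "0 \<le> ternary b" "ternary b \<le> 1 / 2"
proof -
  show "0 \<le> ternary b"
    unfolding ternary_def by (intro suminf_nonneg summable_ternary) simp
  have "ternary b \<le> (\<Sum>n. 1 / 3 ^ Suc n)"
    unfolding ternary_def
    by (intro suminf_le summable_ternary sums_summable[OF third_sums]) (simp add: divide_right_mono)
  then show "ternary b \<le> 1 / 2" using sums_unique[OF third_sums] by simp
qed

lemma ternary_rec: "ternary b = (of_bool (b 0) + ternary (\<lambda>n. b (Suc n))) / 3"
proof -
  have "ternary b = (\<Sum>n. of_bool (b (Suc n)) / 3 ^ Suc (Suc n)) + of_bool (b 0) / 3"
    unfolding ternary_def using suminf_split_head[OF summable_ternary[of b]] by simp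
  also have "(\<Sum>n. of_bool (b (Suc n)) / 3 ^ Suc (Suc n)) = ternary (\<lambda>n. b (Suc n)) / 3"
    unfolding ternary_def using suminf_divide[OF summable_ternary[of "\<lambda>n. b (Suc n)"], of 3]
    by (simp add: field_simps)
  finally show ?thesis by (simp add: field_simps)
qed

lemma ternary_shift: "ternary_shift (ternary b) = ternary (\<lambda>n. b (Suc n))"
  and third_le_ternary: "1 / 3 \<le> ternary b \<longleftrightarrow> b 0"
  using ternary_rec[of b] ternary_bounds[of "\<lambda>n. b (Suc n)"] by (auto simp: ternary_shift_def)

lemma ternary_digit: "ternary_digit n (ternary b) = b n"
proof -
  have "(ternary_shift ^^ n) (ternary b) = ternary (\<lambda>i. b (i + n))"
    by (induction n) (auto simp: ternary_shift)
  then show ?thesis by (simp only: ternary_digit_def third_le_ternary) simp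
qed

lemma measurable_ternary_digit [measurable]: "Measurable.pred borel (ternary_digit n)"
proof -
  have [measurable]: "ternary_shift \<in> borel_measurable borel"
    unfolding ternary_shift_def by measurable
  have [measurable]: "(ternary_shift ^^ n) \<in> borel_measurable borel"
    by (induction n) auto
  show ?thesis unfolding ternary_digit_def by measurable
qed

text \<open>For a dense sequence \<open>D\<close>, the digits of \<open>c x\<close> record whether
  \<open>x\<close> is within \<open>(1 / 2) ^ j\<close> of \<open>D i\<close>, for all pairs
  \<open>(i, j)\<close>. For each \<open>j\<close> the first such centre can be read off; these
  centres converge to \<open>x\<close>, and \<open>s\<close> takes their limit.\<close>

lemma polish_code:
  obtains c :: "'a::polish_space \<Rightarrow> real" and s where
    "c \<in> borel_measurable borel" "s \<in> borel_measurable borel"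
    "\<And>x. 0 \<le> c x" "\<And>x. c x \<le> 1 / 2" "\<And>x. s (c x) = x"
proof -
  obtain D0 :: "'a set" where D0: "countable D0" "\<And>X. open X \<Longrightarrow> X \<noteq> {} \<Longrightarrow> \<exists>d\<in>D0. d \<in> X"
    by (rule countable_dense_setE) blast
  define D where "D = from_nat_into D0"
  have "D0 \<noteq> {}" using D0(2)[of UNIV] by auto
  then have rD: "range D = D0" using range_from_nat_into D0(1) by (auto simp: D_def)
  have dense: "\<exists>i. dist (D i) x < e" if "0 < e" for x e
    using D0(2)[of "ball x e"] that rD by (auto simp: dist_commute)
  define b where "b x n \<longleftrightarrow> dist (D (fst (prod_decode n))) x < (1 / 2) ^ snd (prod_decode n)" for x n
  define c where "c x = ternary (b x)" for x
  define a where "a j t = D (LEAST i. ternary_digit (prod_encode (i, j)) t)" for j t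
  \<comment> \<open>Off the range of \<open>c\<close> the centres need not converge; the constant
    \<open>D 0\<close> then keeps \<open>s\<close> a pointwise limit of Borel maps
    everywhere.\<close>
  define s where "s t = lim (\<lambda>j. if Cauchy (\<lambda>j. a j t) then a j t else D 0)" for t
  have [measurable]: "c \<in> borel_measurable borel"
    unfolding c_def ternary_def b_def by measurable
  have [measurable]: "a j \<in> borel_measurable borel" for j
    unfolding a_def by measurable
  have "s \<in> borel_measurable borel"
  proof (rule borel_measurable_LIMSEQ_metric)
    show "(\<lambda>t. if Cauchy (\<lambda>j. a j t) then a j t else D 0) \<in> borel_measurable borel" for j
      by measurable
    show "(\<lambda>j. if Cauchy (\<lambda>j. a j t) then a j t else D 0) \<longlonglongrightarrow> s t" for t
      unfolding s_def
      by (cases "Cauchy (\<lambda>j. a j t)")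
        (auto simp: convergent_LIMSEQ_iff[symmetric] Cauchy_convergent_iff)
  qed
  moreover have "s (c x) = x" for x
  proof -
    have d: "dist (a j (c x)) x < (1 / 2) ^ j" for j
    proof -
      have "\<exists>i. ternary_digit (prod_encode (i, j)) (c x)"
        using dense[of "(1 / 2) ^ j" x] by (simp add: c_def ternary_digit b_def)
      from LeastI_ex[OF this] show ?thesis
        by (simp add: a_def c_def ternary_digit b_def)
    qed
    have "(\<lambda>j. dist (a j (c x)) x) \<longlonglongrightarrow> 0"
      by (rule tendsto_sandwich[OF _ _ tendsto_const LIMSEQ_power_zero[of "1/2::real"]])
        (auto intro!: always_eventually less_imp_le[OF d])
    then have lim: "(\<lambda>j. a j (c x)) \<longlonglongrightarrow> x" by (subst tendsto_dist_iff)
    then have "Cauchy (\<lambda>j. a j (c x))" by (rule LIMSEQ_imp_Cauchy)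
    then show ?thesis using limI[OF lim] by (simp add: s_def)
  qed
  ultimately show ?thesis
    by (intro that[of c s]) (auto simp only: c_def ternary_bounds \<open>c \<in> borel_measurable borel\<close>)
qed

text \<open>Stated through a real code with a measurable left inverse and without a topology on the
  type, so as to apply to the product of \<open>X\<close> with a finite set of rankings. The bound
  1/2 leaves gaps between codes shifted by different integers.\<close>

definition standard_nonatomic :: "'a measure \<Rightarrow> bool" where
  "standard_nonatomic M \<longleftrightarrow> prob_space M \<and>
     (\<exists>c s. c \<in> borel_measurable M \<and> s \<in> borel \<rightarrow>\<^sub>M M \<and>
        (\<forall>x\<in>space M. 0 \<le> c x \<and> c x \<le> 1 / 2 \<and> s (c x) = x) \<and>
        (\<forall>t::real. measure M (c -` {t} \<inter> space M) = 0))"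

text \<open>Singletons are null, since a singleton has no subset of strictly smaller positive
  measure. The code is injective, so its level sets have at most one point.\<close>

lemma lebesgue_space_standard_nonatomic:
  fixes M :: "'a::polish_space measure"
  assumes "lebesgue_space M"
  shows "standard_nonatomic M"
proof -
  interpret prob_space M using assms by (simp add: lebesgue_space_def)
  have sets [measurable_cong]: "sets M = sets borel" using assms by (simp add: lebesgue_space_def)
  then have sp: "space M = UNIV" by (simp add: sets_eq_imp_space_eq)
  obtain c :: "'a \<Rightarrow> real" and s where c: "c \<in> borel_measurable borel" "s \<in> borel_measurable borel"
    "\<And>x. 0 \<le> c x" "\<And>x. c x \<le> 1 / 2" "\<And>x. s (c x) = x"
    by (rule polish_code[where ?'a = 'a]) blast
  have point: "emeasure M {x} = 0" for x
  proof (rule ccontr)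
    assume "emeasure M {x} \<noteq> 0"
    then have "0 < emeasure M {x}" by (simp add: zero_less_iff_neq_zero)
    moreover have "{x} \<in> sets M" by (simp add: sets)
    ultimately obtain B where "B \<subseteq> {x}" "0 < emeasure M B" "emeasure M B < emeasure M {x}"
      using assms unfolding lebesgue_space_def non_atomic_def by blast
    then show False by (auto simp: subset_singleton_iff)
  qed
  have "measure M (c -` {t} \<inter> space M) = 0" for t
  proof -
    have "c -` {t} \<inter> space M \<subseteq> {s t}" using c(5) by auto
    then have "emeasure M (c -` {t} \<inter> space M) \<le> emeasure M {s t}"
      by (intro emeasure_mono) (auto simp: sets)
    then show ?thesis by (simp add: point measure_def)
  qed
  then show ?thesis
    using c prob_space_axioms unfolding standard_nonatomic_def
    by (intro conjI exI[of _ c] exI[of _ s]) (auto simp: measurable_cong_sets[OF sets refl] measurable_cong_sets[OF refl sets])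
qed

section \<open>The uniform law and isomorphisms through it\<close>

text \<open>Lebesgue measure of the open unit interval, carried by the whole line so that maps into
  and out of it need no restricted domains.\<close>

definition unif :: "real measure" where
  "unif = distr (restrict_space lborel {0<..<1}) borel (\<lambda>x. x)"

lemma sets_unif [simp, measurable_cong]: "sets unif = sets borel"
  and space_unif [simp]: "space unif = UNIV"
  by (simp_all add: unif_def)

lemma measurable_id_unit:
  "(\<lambda>x. x) \<in> restrict_space lborel {0<..<1::real} \<rightarrow>\<^sub>M borel"
  by (simp add: measurable_restrict_space1)

lemma measurable_unif [simp]: "measurable unif N = measurable borel N"
  by (rule measurable_cong_sets) simp_all

lemma AE_unif: "AE u in unif. 0 < u \<and> u < 1"
  unfolding unif_def
  by (subst AE_distr_iff) (auto simp: AE_restrict_space_iff measurable_id_unit)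

text \<open>The distribution function \<open>C\<close> of a code without atoms maps it to the
  uniform law, and the quantile function \<open>J\<close> inverts this almost everywhere; hence
  \<open>p = C \<circ> c\<close> and \<open>q = s \<circ> J\<close>. The last clause keeps track of
  the order of the codes and serves to transport labels.\<close>

lemma uniformize:
  fixes c :: "'a \<Rightarrow> real"
  assumes "prob_space M" and c[measurable]: "c \<in> borel_measurable M"
    and s[measurable]: "s \<in> borel \<rightarrow>\<^sub>M M"
    and sc: "\<And>x. x \<in> space M \<Longrightarrow> s (c x) = x"
    and null: "\<And>t. measure M (c -` {t} \<inter> space M) = 0"
  obtains p q where "p \<in> borel_measurable M" "q \<in> borel \<rightarrow>\<^sub>M M"
    "distr M borel p = unif" "distr unif M q = M"
    "AE u in unif. p (q u) = u" "AE x in M. q (p x) = x"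
    "\<And>j. AE x in M. c x \<le> j \<longleftrightarrow> p x \<le> measure M {x \<in> space M. c x \<le> j}"
proof -
  interpret prob_space M by fact
  interpret D: cdf_distribution "distr M borel c"
    unfolding cdf_distribution_def by (rule real_distribution_distr[OF c])
  define C where "C = cdf (distr M borel c)"
  define J where "J u = (if 0 < u \<and> u < 1 then D.I u else 0)" for u
  have [measurable]: "C \<in> borel_measurable borel" using D.measurable_C by (simp add: C_def)
  have J[measurable]: "J \<in> borel_measurable borel"
  proof -
    have "D.I \<in> borel_measurable (restrict_space borel {0<..<1})" by (rule D.measurable_CI)
    then have "(\<lambda>u. if u \<in> {0<..<1} then D.I u else 0) \<in> borel_measurable borel"
      by (subst (asm) measurable_restrict_space_iff[where c = 0]) auto
    then show ?thesis by (simp add: J_def[abs_def])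
  qed
  have pseudo: "u \<le> C t \<longleftrightarrow> J u \<le> t" if "0 < u" "u < 1" for u t
    using D.pseudoinverse[OF that, of t] that by (simp add: C_def J_def)
  \<comment> \<open>Level sets of the code are null, so \<open>C\<close> is continuous; approaching
    \<open>J u\<close> from the left gives the upper bound.\<close>
  have CJ: "C (J u) = u" if u: "0 < u" "u < 1" for u
  proof (rule antisym)
    have "measure (distr M borel c) {t} = 0" for t by (simp add: measure_distr null)
    then have "isCont C (J u)" unfolding C_def using D.isCont_cdf by simp
    then have "(C \<longlongrightarrow> C (J u)) (at_left (J u))"
      by (auto simp: isCont_def intro: filterlim_mono at_le)
    moreover have "\<forall>\<^sub>F t in at_left (J u). C t \<le> u"
      using pseudo[OF u] by (auto simp: eventually_at_filter intro!: always_eventually) (meson linear not_less)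
    ultimately show "C (J u) \<le> u" by (rule tendsto_upperbound) simp
    show "u \<le> C (J u)" using pseudo[OF u] by simp
  qed
  have dJ: "distr unif borel J = distr M borel c"
  proof -
    have "distr unif borel J = distr (restrict_space lborel {0<..<1}) borel (J \<circ> (\<lambda>x. x))"
      unfolding unif_def by (rule distr_distr) (auto simp: measurable_id_unit)
    also have "\<dots> = distr (restrict_space lborel {0<..<1}) borel D.I"
      by (rule distr_cong) (auto simp: space_restrict_space J_def)
    finally show ?thesis using D.distr_I_eq_M by simp
  qed
  have ACJ: "AE u in unif. C (J u) = u" using AE_unif by eventually_elim (simp add: CJ)
  have AJ: "AE x in M. P (c x)" if "AE u in unif. P (J u)" "Measurable.pred borel P" for P
  proof -
    have "AE t in distr unif borel J. P t" using that by (subst AE_distr_iff) auto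
    then show ?thesis unfolding dJ using that by (subst (asm) AE_distr_iff) auto
  qed
  have AJ': "AE u in unif. P (J u)" if "AE x in M. P (c x)" "Measurable.pred borel P" for P
  proof -
    have "AE t in distr M borel c. P t" using that by (subst AE_distr_iff) auto
    then show ?thesis unfolding dJ[symmetric] using that by (subst (asm) AE_distr_iff) auto
  qed
  define p where "p = C \<circ> c"
  define q where "q = s \<circ> J"
  have [measurable]: "p \<in> borel_measurable M" "q \<in> borel \<rightarrow>\<^sub>M M"
    unfolding p_def q_def by measurable
  have "distr M borel p = distr (distr M borel c) borel C"
    unfolding p_def by (rule distr_distr[symmetric]) auto
  also have "\<dots> = distr unif borel (C \<circ> J)"
    unfolding dJ[symmetric] by (rule distr_distr) auto
  also have "\<dots> = distr unif borel (\<lambda>u. u)"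
    using ACJ by (intro distr_cong_AE) auto
  also have "\<dots> = unif" by (rule distr_id2) simp
  finally have 1: "distr M borel p = unif" .
  have "distr unif M q = distr (distr unif borel J) M s"
    unfolding q_def by (rule distr_distr[symmetric]) auto
  also have "\<dots> = distr M M (s \<circ> c)"
    unfolding dJ by (rule distr_distr) auto
  also have "\<dots> = distr M M (\<lambda>x. x)"
    by (rule distr_cong) (auto simp: sc)
  finally have 2: "distr unif M q = M" by (simp add: distr_id2)
  \<comment> \<open>The identity \<open>c (s t) = t\<close> holds on the values of \<open>c\<close>,
    and \<open>J\<close> under \<open>unif\<close> has the same law as \<open>c\<close>.\<close>
  have "AE u in unif. c (s (J u)) = J u"
    by (rule AJ') (auto simp: sc)
  then have 3: "AE u in unif. p (q u) = u"
    using ACJ by eventually_elim (simp add: p_def q_def)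
  have JC: "AE x in M. J (C (c x)) = c x"
    by (rule AJ) (use ACJ in \<open>eventually_elim, simp\<close>, measurable)
  have 4: "AE x in M. q (p x) = x"
    using JC AE_space by eventually_elim (simp add: p_def q_def sc)
  have 5: "AE x in M. c x \<le> j \<longleftrightarrow> p x \<le> measure M {x \<in> space M. c x \<le> j}" for j
  proof -
    have Cj: "C j = measure M {x \<in> space M. c x \<le> j}"
      by (simp add: C_def cdf_def measure_distr vimage_def Int_def conj_commute)
    have "AE x in M. 0 < C (c x) \<and> C (c x) < 1"
    proof (rule AJ)
      show "AE u in unif. 0 < C (J u) \<and> C (J u) < 1"
        using ACJ AE_unif by eventually_elim simp
    qed measurable
    with JC show ?thesis
    proof eventually_elim
      case (elim x)
      then show ?case using pseudo[of "C (c x)" j] by (simp add: p_def Cj[symmetric])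
    qed
  qed
  have "p \<in> borel_measurable M" "q \<in> borel \<rightarrow>\<^sub>M M" by measurable
  then show ?thesis by (rule that[OF _ _ 1 2 3 4 5])
qed

text \<open>Adding the integer label to the code turns the labels into consecutive blocks of the
  line. Uniformization keeps their order, and equal cumulative measures put corresponding blocks at
  the same place in the unit interval. So one uniformization followed by the inverse of the other
  respects labels.\<close>

lemma standard_nonatomic_isomorphism:
  fixes a :: "'a \<Rightarrow> nat" and b :: "'b \<Rightarrow> nat"
  assumes "standard_nonatomic M" "standard_nonatomic P"
    and a[measurable]: "a \<in> M \<rightarrow>\<^sub>M count_space UNIV" and b[measurable]: "b \<in> P \<rightarrow>\<^sub>M count_space UNIV"
    and eq: "\<And>j. measure M {x \<in> space M. a x \<le> j} = measure P {x \<in> space P. b x \<le> j}"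
  obtains \<theta> \<theta>' where "\<theta> \<in> M \<rightarrow>\<^sub>M P" "\<theta>' \<in> P \<rightarrow>\<^sub>M M" "distr M P \<theta> = P" "distr P M \<theta>' = M"
    "AE x in M. \<theta>' (\<theta> x) = x" "AE z in P. \<theta> (\<theta>' z) = z" "AE x in M. b (\<theta> x) = a x"
proof -
  have code: "\<exists>c s. c \<in> borel_measurable N \<and> s \<in> borel \<rightarrow>\<^sub>M N \<and>
        (\<forall>x\<in>space N. s (c x) = x \<and> (\<forall>j::nat. c x \<le> real j + 1 / 2 \<longleftrightarrow> d x \<le> j)) \<and>
        (\<forall>t::real. measure N (c -` {t} \<inter> space N) = 0)"
    if sn: "standard_nonatomic N" and d[measurable]: "d \<in> N \<rightarrow>\<^sub>M count_space UNIV"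
    for N :: "'c measure" and d :: "'c \<Rightarrow> nat"
  proof -
    interpret prob_space N using sn by (simp add: standard_nonatomic_def)
    obtain c s where [measurable]: "c \<in> borel_measurable N" "s \<in> borel \<rightarrow>\<^sub>M N" and
      c: "\<forall>x\<in>space N. 0 \<le> c x \<and> c x \<le> 1 / 2 \<and> s (c x) = x" and
      null: "\<forall>t::real. measure N (c -` {t} \<inter> space N) = 0"
      using sn unfolding standard_nonatomic_def by blast
    \<comment> \<open>As \<open>c x\<close> is between 0 and 1/2, the floor of \<open>c' x\<close>
      recovers the label, and \<open>j + 1 / 2\<close> separates the labels up to \<open>j\<close>
      from the later ones.\<close>
    define c' where "c' x = real (d x) + c x" for x
    define s' where "s' t = s (t - real_of_int \<lfloor>t\<rfloor>)" for t
    have fl: "\<lfloor>c' x\<rfloor> = int (d x)" if "x \<in> space N" for x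
      using bspec[OF c that] unfolding c'_def by linarith
    have "measure N (c' -` {t} \<inter> space N) = 0" for t
    proof -
      have "measure N (c' -` {t} \<inter> space N) \<le> measure N (c -` {t - real_of_int \<lfloor>t\<rfloor>} \<inter> space N)"
        by (rule finite_measure_mono) (auto simp: fl, simp add: c'_def)
      then show ?thesis using null by (simp add: measure_le_0_iff)
    qed
    moreover have "s' (c' x) = x" if "x \<in> space N" for x
      using bspec[OF c that] fl[OF that] by (simp add: s'_def c'_def)
    moreover have "c' x \<le> real j + 1 / 2 \<longleftrightarrow> d x \<le> j" if "x \<in> space N" for x j
    proof -
      have "d x \<le> j \<or> real j + 1 \<le> real (d x)" by linarith
      then show ?thesis using bspec[OF c that] unfolding c'_def by auto
    qed
    moreover have "c' \<in> borel_measurable N" "s' \<in> borel \<rightarrow>\<^sub>M N"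
      unfolding c'_def s'_def by measurable
    ultimately show ?thesis by blast
  qed
  obtain c1 s1 where c1: "c1 \<in> borel_measurable M" "s1 \<in> borel \<rightarrow>\<^sub>M M"
      "\<forall>x\<in>space M. s1 (c1 x) = x \<and> (\<forall>j::nat. c1 x \<le> real j + 1 / 2 \<longleftrightarrow> a x \<le> j)"
      "\<forall>t::real. measure M (c1 -` {t} \<inter> space M) = 0"
    using code[OF assms(1) a] by blast
  obtain c2 s2 where c2: "c2 \<in> borel_measurable P" "s2 \<in> borel \<rightarrow>\<^sub>M P"
      "\<forall>x\<in>space P. s2 (c2 x) = x \<and> (\<forall>j::nat. c2 x \<le> real j + 1 / 2 \<longleftrightarrow> b x \<le> j)"
      "\<forall>t::real. measure P (c2 -` {t} \<inter> space P) = 0"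
    using code[OF assms(2) b] by blast
  have "prob_space M" "prob_space P" using assms(1,2) by (auto simp: standard_nonatomic_def)
  obtain p1 q1 where [measurable]: "p1 \<in> borel_measurable M" "q1 \<in> borel \<rightarrow>\<^sub>M M"
    and 1: "distr M borel p1 = unif" "distr unif M q1 = M"
    "AE u in unif. p1 (q1 u) = u" "AE x in M. q1 (p1 x) = x"
    "\<And>j. AE x in M. c1 x \<le> j \<longleftrightarrow> p1 x \<le> measure M {x \<in> space M. c1 x \<le> j}"
    using uniformize[OF \<open>prob_space M\<close> c1(1,2)] c1(3,4) by blast
  obtain p2 q2 where [measurable]: "p2 \<in> borel_measurable P" "q2 \<in> borel \<rightarrow>\<^sub>M P"
    and 2: "distr P borel p2 = unif" "distr unif P q2 = P"
    "AE u in unif. p2 (q2 u) = u" "AE x in P. q2 (p2 x) = x"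
    "\<And>j. AE x in P. c2 x \<le> j \<longleftrightarrow> p2 x \<le> measure P {x \<in> space P. c2 x \<le> j}"
    using uniformize[OF \<open>prob_space P\<close> c2(1,2)] c2(3,4) by blast
  have via: "distr N L (g \<circ> f) = L" if "f \<in> borel_measurable N" "g \<in> borel \<rightarrow>\<^sub>M L"
     "distr N borel f = unif" "distr unif L g = L"
    for N :: "'c measure" and L :: "'d measure" and f g
    using that by (subst distr_distr[symmetric]) auto
  have pull: "AE x in N. R (f x)" if "f \<in> borel_measurable N" "distr N borel f = unif"
      "AE u in unif. R u"
    for N :: "'c measure" and f R
    by (rule AE_distrD[OF that(1), of R], unfold that(2), rule that(3))
  have pull': "AE x in unif. R (f x)" if "f \<in> borel \<rightarrow>\<^sub>M N" "distr unif N f = N" "AE u in N. R u"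
    for N :: "'c measure" and f R
    by (rule AE_distrD[of f unif N R], use that in simp, unfold that(2), rule that(3))
  have inv: "AE x in M. q1 (p2 (q2 (p1 x))) = x"
    using pull[OF \<open>p1 \<in> borel_measurable M\<close> 1(1) 2(3)] 1(4) by eventually_elim auto
  have inv': "AE z in P. q2 (p1 (q1 (p2 z))) = z"
    using pull[OF \<open>p2 \<in> borel_measurable P\<close> 2(1) 1(3)] 2(4) by eventually_elim auto
  have lab: "AE x in M. b (q2 (p1 x)) \<le> j \<longleftrightarrow> a x \<le> j" for j :: nat
  proof -
    let ?t = "real j + 1 / 2"
    have m: "measure M {x \<in> space M. c1 x \<le> ?t} = measure P {x \<in> space P. c2 x \<le> ?t}"
    proof -
      have "{x \<in> space M. c1 x \<le> ?t} = {x \<in> space M. a x \<le> j}" using c1(3) by auto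
      moreover have "{x \<in> space P. c2 x \<le> ?t} = {x \<in> space P. b x \<le> j}" using c2(3) by auto
      ultimately show ?thesis using eq by simp
    qed
    have "AE u in unif. c2 (q2 u) \<le> ?t \<longleftrightarrow> p2 (q2 u) \<le> measure P {x \<in> space P. c2 x \<le> ?t}"
      by (rule pull'[OF _ 2(2) 2(5)]) simp
    with 2(3) have "AE u in unif. c2 (q2 u) \<le> ?t \<longleftrightarrow> u \<le> measure P {x \<in> space P. c2 x \<le> ?t}"
      by eventually_elim simp
    from pull[OF _ 1(1) this]
    have "AE x in M. c2 (q2 (p1 x)) \<le> ?t \<longleftrightarrow> p1 x \<le> measure M {x \<in> space M. c1 x \<le> ?t}"
      unfolding m by simp
    with 1(5)[of ?t] AE_space show ?thesis
    proof eventually_elim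
      case (elim x)
      have "q2 (p1 x) \<in> space P" by (rule measurable_space[of q2 borel]) auto
      then show ?case using elim c1(3) c2(3) by simp
    qed
  qed
  have "AE x in M. \<forall>j. b (q2 (p1 x)) \<le> j \<longleftrightarrow> a x \<le> j"
    using lab by (simp add: AE_all_countable)
  then have "AE x in M. b (q2 (p1 x)) = a x"
    by eventually_elim (meson le_antisym order_refl)
  then show ?thesis
    by (intro that[of "q2 \<circ> p1" "q1 \<circ> p2"] via) (use inv inv' 1 2 in \<open>auto simp: comp_def\<close>)
qed

section \<open>The automorphism group\<close>

lemma AE_pullback:
  assumes "T \<in> M \<rightarrow>\<^sub>M N" "distr M N T = N" "AE y in N. Q y"
  shows "AE x in M. Q (T x)"
  by (rule AE_distrD[OF assms(1), of Q], unfold assms(2), rule assms(3))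

lemma measure_pullback:
  assumes "T \<in> M \<rightarrow>\<^sub>M N" "distr M N T = N" "A \<in> sets N"
  shows "measure M (T -` A \<inter> space M) = measure N A"
  using measure_distr[OF assms(1,3)] assms(2) by simp

lemma measure_preserving_comp:
  assumes "measure_preserving M S" "measure_preserving M T"
  shows "measure_preserving M (S \<circ> T)"
  using assms distr_distr[of S M M T M] by (auto simp: measure_preserving_def comp_def)

lemma invertible_mptD:
  assumes "T \<in> invertible_mpt M"
  shows "T \<in> M \<rightarrow>\<^sub>M M" "distr M M T = M"
  using assms by (auto simp: invertible_mpt_def measure_preserving_def)

lemma invertible_mptI:
  assumes "T \<in> M \<rightarrow>\<^sub>M M" "distr M M T = M" "S \<in> M \<rightarrow>\<^sub>M M" "distr M M S = M"
    "AE x in M. S (T x) = x" "AE x in M. T (S x) = x"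
  shows "T \<in> invertible_mpt M"
  using assms by (auto simp: invertible_mpt_def measure_preserving_def)

lemma invertible_mpt_comp:
  assumes "S \<in> invertible_mpt M" "T \<in> invertible_mpt M"
  shows "S \<circ> T \<in> invertible_mpt M"
proof -
  obtain S' T' where S': "measure_preserving M S'" "AE x in M. S' (S x) = x" "AE x in M. S (S' x) = x"
    and T': "measure_preserving M T'" "AE x in M. T' (T x) = x" "AE x in M. T (T' x) = x"
    using assms unfolding invertible_mpt_def by blast
  have mp: "measure_preserving M S" "measure_preserving M T"
    using assms by (auto simp: invertible_mpt_def)
  have "AE x in M. (T' \<circ> S') ((S \<circ> T) x) = x"
  proof -
    have "AE x in M. S' (S (T x)) = T x"
      by (rule AE_pullback[OF invertible_mptD[OF assms(2)] S'(2)])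
    with T'(2) show ?thesis by eventually_elim simp
  qed
  moreover have "AE x in M. (S \<circ> T) ((T' \<circ> S') x) = x"
  proof -
    have "AE x in M. T (T' (S' x)) = S' x"
      using S'(1) by (intro AE_pullback[OF _ _ T'(3)]) (auto simp: measure_preserving_def)
    with S'(3) show ?thesis by eventually_elim simp
  qed
  ultimately show ?thesis
    using measure_preserving_comp[OF mp] measure_preserving_comp[OF T'(1) S'(1)]
    unfolding invertible_mpt_def by blast
qed

lemma equiv_ae_equal: "equiv (invertible_mpt M) (ae_equal M)"
proof (rule equivI)
  show "ae_equal M \<subseteq> invertible_mpt M \<times> invertible_mpt M" by (auto simp: ae_equal_def)
  show "refl_on (invertible_mpt M) (ae_equal M)" by (auto simp: ae_equal_def refl_on_def)
  show "sym (ae_equal M)" by (auto simp: ae_equal_def sym_def elim!: eventually_mono)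
  show "trans (ae_equal M)"
  proof (rule transI)
    fix S T U assume "(S, T) \<in> ae_equal M" "(T, U) \<in> ae_equal M"
    then have *: "S \<in> invertible_mpt M" "U \<in> invertible_mpt M" "AE x in M. S x = T x" "AE x in M. T x = U x"
      by (auto simp: ae_equal_def)
    from *(3,4) have "AE x in M. S x = U x" by eventually_elim simp
    with * show "(S, U) \<in> ae_equal M" by (simp add: ae_equal_def)
  qed
qed

abbreviation ae_class :: "'a measure \<Rightarrow> ('a \<Rightarrow> 'a) \<Rightarrow> ('a \<Rightarrow> 'a) set" where
  "ae_class M T \<equiv> ae_equal M `` {T}"

lemma ae_class_in_Aut: "T \<in> invertible_mpt M \<Longrightarrow> ae_class M T \<in> carrier (Aut M)"
  by (simp add: Aut_def quotientI)

lemma ae_class_self: "T \<in> invertible_mpt M \<Longrightarrow> T \<in> ae_class M T"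
  by (simp add: ae_equal_def)

lemma ae_class_eq:
  assumes "S \<in> invertible_mpt M" "T \<in> invertible_mpt M" "AE x in M. S x = T x"
  shows "ae_class M S = ae_class M T"
  by (rule equiv_class_eq[OF equiv_ae_equal]) (use assms in \<open>simp add: ae_equal_def\<close>)

lemma Aut_carrierD:
  assumes "c \<in> carrier (Aut M)" "T \<in> c"
  shows "T \<in> invertible_mpt M" "c = ae_class M T"
proof -
  from assms obtain S where S: "S \<in> invertible_mpt M" "c = ae_class M S"
    by (auto simp: Aut_def elim!: quotientE)
  with assms have "(S, T) \<in> ae_equal M" by simp
  then show "T \<in> invertible_mpt M" "c = ae_class M T"
    using S equiv_class_eq[OF equiv_ae_equal] by (auto simp: ae_equal_def)
qed

lemma Aut_carrier_nonempty: "c \<in> carrier (Aut M) \<Longrightarrow> \<exists>T. T \<in> c"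
  using in_quotient_imp_non_empty[OF equiv_ae_equal] by (fastforce simp: Aut_def)

text \<open>Independence of representatives: \<open>S\<close> and \<open>S'\<close> differ on a null
  set, whose preimage under the measure-preserving \<open>T\<close> is null.\<close>

lemma Aut_mult:
  assumes "S \<in> invertible_mpt M" "T \<in> invertible_mpt M"
  shows "ae_class M S \<otimes>\<^bsub>Aut M\<^esub> ae_class M T = ae_class M (S \<circ> T)"
proof -
  have "ae_class M (S' \<circ> T') = ae_class M (S \<circ> T)" if "S' \<in> ae_class M S" "T' \<in> ae_class M T" for S' T'
  proof (rule ae_class_eq)
    have *: "S' \<in> invertible_mpt M" "T' \<in> invertible_mpt M" "AE x in M. S x = S' x" "AE x in M. T x = T' x"
      using that by (auto simp: ae_equal_def)
    then show "S' \<circ> T' \<in> invertible_mpt M" "S \<circ> T \<in> invertible_mpt M"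
      using assms by (auto intro: invertible_mpt_comp)
    have "AE x in M. S (T x) = S' (T x)"
      by (rule AE_pullback[OF invertible_mptD[OF assms(2)] *(3)])
    with *(4) show "AE x in M. (S' \<circ> T') x = (S \<circ> T) x" by eventually_elim simp
  qed
  then have "(\<Union>S'\<in>ae_class M S. \<Union>T'\<in>ae_class M T. ae_class M (S' \<circ> T'))
      = (\<Union>S'\<in>ae_class M S. \<Union>T'\<in>ae_class M T. ae_class M (S \<circ> T))"
    by (intro SUP_cong refl)
  also have "\<dots> = ae_class M (S \<circ> T)"
    using ae_class_self[OF assms(1)] ae_class_self[OF assms(2)] by blast
  finally show ?thesis by (simp only: Aut_def monoid.simps)
qed

lemma act:
  assumes "\<alpha> \<in> actions G M" "g \<in> carrier G"
  shows act_mem: "act \<alpha> g \<in> \<alpha> g"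
    and act_invertible: "act \<alpha> g \<in> invertible_mpt M"
    and ae_class_act: "\<alpha> g = ae_class M (act \<alpha> g)"
proof -
  have *: "\<alpha> g \<in> carrier (Aut M)" using assms by (auto simp: actions_def hom_def)
  then show "act \<alpha> g \<in> \<alpha> g" unfolding act_def using Aut_carrier_nonempty by (metis someI_ex)
  then show "act \<alpha> g \<in> invertible_mpt M" "\<alpha> g = ae_class M (act \<alpha> g)"
    using Aut_carrierD[OF *] by blast+
qed

text \<open>Representatives are chosen separately for each group element, so the homomorphism law
  passes to them only almost everywhere.\<close>

lemma act_mult:
  assumes "\<alpha> \<in> actions G M" "g \<in> carrier G" "h \<in> carrier G" "g \<otimes>\<^bsub>G\<^esub> h \<in> carrier G"
  shows "AE x in M. act \<alpha> (g \<otimes>\<^bsub>G\<^esub> h) x = act \<alpha> g (act \<alpha> h x)"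
proof -
  have "ae_class M (act \<alpha> (g \<otimes>\<^bsub>G\<^esub> h)) = \<alpha> g \<otimes>\<^bsub>Aut M\<^esub> \<alpha> h"
    using assms by (simp add: ae_class_act[symmetric] actions_def hom_def)
  also have "\<dots> = ae_class M (act \<alpha> g \<circ> act \<alpha> h)"
    using assms by (simp add: ae_class_act[of \<alpha> G M g] ae_class_act[of \<alpha> G M h] Aut_mult act_invertible)
  finally have "act \<alpha> g \<circ> act \<alpha> h \<in> ae_class M (act \<alpha> (g \<otimes>\<^bsub>G\<^esub> h))"
    using ae_class_self invertible_mpt_comp act_invertible assms by metis
  then show ?thesis by (simp add: ae_equal_def)
qed

section \<open>Approximation by actions with finite image\<close>

text \<open>Points of \<open>M\<close> are labelled by the subfamily of \<open>\<A>\<close> whose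
  sets contain them, points of \<open>P\<close> by the label of their image under
  \<open>\<pi>\<close>. Both labels have the same law because \<open>\<pi>\<close> preserves
  measure, and an isomorphism matching the labels respects each set of the family.\<close>

lemma standard_nonatomic_isomorphism_sets:
  assumes "standard_nonatomic M" "standard_nonatomic P"
    and \<pi>[measurable]: "\<pi> \<in> P \<rightarrow>\<^sub>M M" and "distr P M \<pi> = M" and \<A>: "finite \<A>" "\<A> \<subseteq> sets M"
  obtains \<theta> \<theta>' where "\<theta> \<in> M \<rightarrow>\<^sub>M P" "\<theta>' \<in> P \<rightarrow>\<^sub>M M" "distr M P \<theta> = P" "distr P M \<theta>' = M"
    "AE x in M. \<theta>' (\<theta> x) = x" "AE z in P. \<theta> (\<theta>' z) = z"
    "\<And>A. A \<in> \<A> \<Longrightarrow> AE x in M. \<pi> (\<theta> x) \<in> A \<longleftrightarrow> x \<in> A"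
proof -
  obtain i :: "'a set set \<Rightarrow> nat" where i: "inj_on i (Pow \<A>)"
    using finite_imp_inj_to_nat_seg[of "Pow \<A>"] \<A> by auto
  define a where "a x = i {A \<in> \<A>. x \<in> A}" for x
  have a[measurable]: "a \<in> M \<rightarrow>\<^sub>M count_space UNIV"
  proof (subst measurable_count_space_eq2_countable, simp, safe)
    fix n
    have "a -` {n} \<inter> space M = (\<Union>\<B>\<in>{\<B> \<in> Pow \<A>. i \<B> = n}. {x \<in> space M. \<forall>A\<in>\<A>. x \<in> A \<longleftrightarrow> A \<in> \<B>})"
    proof (rule Set.set_eqI, rule iffI)
      fix x assume "x \<in> (\<Union>\<B>\<in>{\<B> \<in> Pow \<A>. i \<B> = n}. {x \<in> space M. \<forall>A\<in>\<A>. x \<in> A \<longleftrightarrow> A \<in> \<B>})"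
      then obtain \<B> where B: "\<B> \<subseteq> \<A>" "i \<B> = n" "x \<in> space M" "\<forall>A\<in>\<A>. x \<in> A \<longleftrightarrow> A \<in> \<B>" by blast
      then have "{A \<in> \<A>. x \<in> A} = \<B>" by blast
      then show "x \<in> a -` {n} \<inter> space M" using B by (simp add: a_def)
    next
      fix x assume "x \<in> a -` {n} \<inter> space M"
      then show "x \<in> (\<Union>\<B>\<in>{\<B> \<in> Pow \<A>. i \<B> = n}. {x \<in> space M. \<forall>A\<in>\<A>. x \<in> A \<longleftrightarrow> A \<in> \<B>})"
        by (intro UN_I[of "{A \<in> \<A>. x \<in> A}"]) (auto simp: a_def)
    qed
    also have "\<dots> \<in> sets M"
    proof (rule sets.finite_UN)
      show "finite {\<B> \<in> Pow \<A>. i \<B> = n}" using \<A> by simp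
      show "{x \<in> space M. \<forall>A\<in>\<A>. x \<in> A \<longleftrightarrow> A \<in> \<B>} \<in> sets M" for \<B>
      proof (rule sets.sets_Collect_finite_All[OF _ \<A>(1)])
        show "{x \<in> space M. x \<in> A \<longleftrightarrow> A \<in> \<B>} \<in> sets M" if "A \<in> \<A>" for A
        proof -
          have [measurable]: "A \<in> sets M" using that \<A>(2) by auto
          show ?thesis by measurable
        qed
      qed
    qed
    finally show "a -` {n} \<inter> space M \<in> sets M" .
  qed
  have "measure M {x \<in> space M. a x \<le> j} = measure P {z \<in> space P. (a \<circ> \<pi>) z \<le> j}" for j
  proof -
    have "\<pi> -` {x \<in> space M. a x \<le> j} \<inter> space P = {z \<in> space P. (a \<circ> \<pi>) z \<le> j}"
      using measurable_space[OF \<pi>] by auto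
    moreover have "{x \<in> space M. a x \<le> j} \<in> sets M" by measurable
    ultimately show ?thesis
      using measure_pullback[OF \<pi> assms(4), of "{x \<in> space M. a x \<le> j}"] by simp
  qed
  then obtain \<theta> \<theta>' where \<theta>: "\<theta> \<in> M \<rightarrow>\<^sub>M P" "\<theta>' \<in> P \<rightarrow>\<^sub>M M" "distr M P \<theta> = P" "distr P M \<theta>' = M"
    "AE x in M. \<theta>' (\<theta> x) = x" "AE z in P. \<theta> (\<theta>' z) = z" and lab: "AE x in M. (a \<circ> \<pi>) (\<theta> x) = a x"
    by (rule standard_nonatomic_isomorphism[OF assms(1,2) a measurable_comp[OF \<pi> a]]) blast
  have "AE x in M. \<pi> (\<theta> x) \<in> A \<longleftrightarrow> x \<in> A" if A: "A \<in> \<A>" for A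
    using lab
  proof eventually_elim
    case (elim x)
    then have "{A \<in> \<A>. \<pi> (\<theta> x) \<in> A} = {A \<in> \<A>. x \<in> A}"
      by (intro inj_onD[OF i]) (auto simp: a_def)
    then show ?case using A by blast
  qed
  with \<theta> show ?thesis by (rule that)
qed

section \<open>Products with a finite uniform space\<close>

lemma measurable_uniform_count:
  "r \<in> \<Omega> \<rightarrow> \<Omega>' \<Longrightarrow> r \<in> uniform_count_measure \<Omega> \<rightarrow>\<^sub>M uniform_count_measure \<Omega>'"
  by (rule measurableI) (auto simp: sets_uniform_count_measure space_uniform_count_measure)

lemma measurable_uniform_count_pair:
  assumes "finite \<Omega>" "\<And>v. v \<in> \<Omega> \<Longrightarrow> (\<lambda>x. k v x) \<in> M \<rightarrow>\<^sub>M N"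
  shows "(\<lambda>z. k (fst z) (snd z)) \<in> uniform_count_measure \<Omega> \<Otimes>\<^sub>M M \<rightarrow>\<^sub>M N"
proof -
  have "(\<lambda>z. k (fst z) (snd z)) \<in> count_space \<Omega> \<Otimes>\<^sub>M M \<rightarrow>\<^sub>M N"
    using assms by (intro measurable_pair_measure_countable1) (auto intro: countable_finite)
  then show ?thesis
    by (simp cong: measurable_cong_sets add: sets_pair_measure_cong[OF sets_uniform_count_measure_count_space refl])
qed

text \<open>By Fubini the law of the map is the average over \<open>v\<close> of the laws of
  \<open>k v\<close>, each of which is \<open>N\<close>.\<close>

lemma distr_uniform_count_pair:
  assumes "finite \<Omega>" "\<Omega> \<noteq> {}" "prob_space M"
    and k: "\<And>v. v \<in> \<Omega> \<Longrightarrow> k v \<in> M \<rightarrow>\<^sub>M N" "\<And>v. v \<in> \<Omega> \<Longrightarrow> distr M N (k v) = N"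
  shows "distr (uniform_count_measure \<Omega> \<Otimes>\<^sub>M M) N (\<lambda>z. k (fst z) (snd z)) = N"
proof (rule measure_eqI)
  interpret M: prob_space M by fact
  interpret U: prob_space "uniform_count_measure \<Omega>" by (rule prob_space_uniform_count_measure[OF assms(1,2)])
  let ?P = "uniform_count_measure \<Omega> \<Otimes>\<^sub>M M" and ?\<pi> = "\<lambda>z. k (fst z) (snd z)"
  have meas: "?\<pi> \<in> ?P \<rightarrow>\<^sub>M N"
    by (rule measurable_uniform_count_pair[OF assms(1)]) (rule k(1))
  fix A assume "A \<in> sets (distr ?P N ?\<pi>)"
  then have A: "A \<in> sets N" by simp
  have "emeasure (distr ?P N ?\<pi>) A = emeasure ?P (?\<pi> -` A \<inter> space ?P)"
    by (rule emeasure_distr[OF meas A])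
  also have "\<dots> = (\<integral>\<^sup>+v. emeasure M (Pair v -` (?\<pi> -` A \<inter> space ?P)) \<partial>uniform_count_measure \<Omega>)"
    by (rule M.emeasure_pair_measure_alt) (rule measurable_sets[OF meas A])
  also have "\<dots> = (\<integral>\<^sup>+v. emeasure N A \<partial>uniform_count_measure \<Omega>)"
  proof (rule nn_integral_cong)
    fix v assume "v \<in> space (uniform_count_measure \<Omega>)"
    then have v: "v \<in> \<Omega>" by (simp add: space_uniform_count_measure)
    then have "Pair v -` (?\<pi> -` A \<inter> space ?P) = k v -` A \<inter> space M"
      by (auto simp: space_pair_measure space_uniform_count_measure)
    then show "emeasure M (Pair v -` (?\<pi> -` A \<inter> space ?P)) = emeasure N A"
      using emeasure_distr[OF k(1)[OF v] A] k(2)[OF v] by simp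
  qed
  also have "\<dots> = emeasure N A" by (simp add: U.emeasure_space_1)
  finally show "emeasure (distr ?P N ?\<pi>) A = emeasure N A" .
qed simp

text \<open>The codes of the fibres are placed side by side: index plus code, divided by
  \<open>2 * m\<close> to stay within the bound 1/2. After rescaling, the floor recovers the
  fibre.\<close>

lemma standard_nonatomic_uniform_count_pair:
  assumes "finite \<Omega>" "\<Omega> \<noteq> {}" "standard_nonatomic M"
  shows "standard_nonatomic (uniform_count_measure \<Omega> \<Otimes>\<^sub>M M)"
proof -
  let ?U = "uniform_count_measure \<Omega>"
  let ?P = "?U \<Otimes>\<^sub>M M"
  interpret M: prob_space M using assms by (simp add: standard_nonatomic_def)
  interpret U: prob_space ?U by (rule prob_space_uniform_count_measure[OF assms(1,2)])
  interpret P: pair_prob_space ?U M ..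
  obtain c s where [measurable]: "c \<in> borel_measurable M" "s \<in> borel \<rightarrow>\<^sub>M M"
    and c: "\<forall>x\<in>space M. 0 \<le> c x \<and> c x \<le> 1 / 2 \<and> s (c x) = x"
    and null: "\<forall>t::real. measure M (c -` {t} \<inter> space M) = 0"
    using assms(3) unfolding standard_nonatomic_def by blast
  define m where "m = card \<Omega>"
  have m: "0 < m" using assms by (auto simp: m_def card_gt_0_iff)
  obtain h where h: "bij_betw h {0..<m} \<Omega>" unfolding m_def using ex_bij_betw_nat_finite assms(1) by blast
  define idx where "idx = inv_into {0..<m} h"
  have idx: "idx v < m" "h (idx v) = v" if "v \<in> \<Omega>" for v
    using that h bij_betw_inv_into_right[OF h that] bij_betwE[OF bij_betw_inv_into[OF h]]
    by (auto simp: idx_def)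
  \<comment> \<open>Indices out of range go to \<open>h 0\<close>, so that the decoder
    \<open>S\<close> takes all its values in the product space.\<close>
  define e where "e n = (if n < m then h n else h 0)" for n
  have e: "e n \<in> \<Omega>" for n using h m by (auto simp: e_def bij_betw_def)
  define k where "k v x = (real (idx v) + c x) / (2 * real m)" for v x
  define C where "C z = k (fst z) (snd z)" for z
  define S where "S t = (e (nat \<lfloor>2 * real m * t\<rfloor>), s (2 * real m * t - real_of_int \<lfloor>2 * real m * t\<rfloor>))" for t
  have C[measurable]: "C \<in> borel_measurable ?P"
    unfolding C_def[abs_def] by (rule measurable_uniform_count_pair[OF assms(1)]) (simp add: k_def)
  have "e \<in> count_space UNIV \<rightarrow>\<^sub>M ?U"
    using e by (simp add: space_uniform_count_measure)
  then have "(\<lambda>t. e (nat \<lfloor>2 * real m * t\<rfloor>)) \<in> borel \<rightarrow>\<^sub>M ?U"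
    by (rule measurable_compose[rotated]) measurable
  then have S: "S \<in> borel \<rightarrow>\<^sub>M ?P"
    unfolding S_def[abs_def] by (rule measurable_Pair) measurable
  have CS: "0 \<le> C z \<and> C z \<le> 1 / 2 \<and> S (C z) = z" if z: "z \<in> space ?P" for z
  proof -
    obtain v x where vx: "z = (v, x)" "v \<in> \<Omega>" "x \<in> space M"
      using z by (auto simp: space_pair_measure space_uniform_count_measure)
    have b: "0 \<le> c x" "c x \<le> 1 / 2" "s (c x) = x" using c vx by auto
    have "real (idx v) + c x \<le> real m" using b idx(1)[OF vx(2)] by linarith
    then have "0 \<le> C z" "C z \<le> 1 / 2" using b m by (auto simp: C_def k_def vx field_simps)
    moreover have t: "2 * real m * C z = real (idx v) + c x" using m by (simp add: C_def k_def vx)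
    moreover have fl: "\<lfloor>real (idx v) + c x\<rfloor> = int (idx v)" using b by linarith
    have "S (C z) = z"
      unfolding S_def t fl using b idx[OF vx(2)] by (simp add: e_def vx)
    ultimately show ?thesis by blast
  qed
  have "measure ?P (C -` {t} \<inter> space ?P) = 0" for t
  proof -
    have "emeasure ?P (C -` {t} \<inter> space ?P) = (\<integral>\<^sup>+v. emeasure M (Pair v -` (C -` {t} \<inter> space ?P)) \<partial>?U)"
      by (rule M.emeasure_pair_measure_alt) simp
    also have "\<dots> = (\<integral>\<^sup>+v. 0 \<partial>?U)"
    proof (rule nn_integral_cong)
      fix v assume "v \<in> space ?U"
      have "Pair v -` (C -` {t} \<inter> space ?P) \<subseteq> c -` {2 * real m * t - real (idx v)} \<inter> space M"
        using m by (auto simp: C_def k_def space_pair_measure field_simps)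
      then have "emeasure M (Pair v -` (C -` {t} \<inter> space ?P)) \<le> emeasure M (c -` {2 * real m * t - real (idx v)} \<inter> space M)"
        by (rule emeasure_mono) simp
      also have "\<dots> = 0" using null by (simp add: M.emeasure_eq_measure)
      finally show "emeasure M (Pair v -` (C -` {t} \<inter> space ?P)) = 0" by simp
    qed
    finally show ?thesis by (simp add: measure_def)
  qed
  with CS C S P.prob_space_axioms show ?thesis
    unfolding standard_nonatomic_def by blast
qed

section \<open>Transport of a permutation action to \<open>X\<close>\<close>

text \<open>The approximating map for \<open>g\<close> is determined by the permutation that
  \<open>g\<close> induces on \<open>\<Omega>\<close>, so only finitely many occur. Its error on a
  set of \<open>\<A>\<close> is confined to points whose first coordinate violates the equivariance
  of \<open>f\<close>, a proportion bounded by a Folner ratio.\<close>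

lemma finite_image_actions_approximate:
  fixes G :: "('g, 'r) monoid_scheme" (structure) and M :: "'a::polish_space measure"
  assumes "group G" "residually_finite G" "folner_sequence G F" "lebesgue_space M"
    and \<alpha>: "\<alpha> \<in> actions G M" and S: "finite S" "S \<subseteq> carrier G"
    and \<A>: "finite \<A>" "\<A> \<subseteq> sets M" and "0 < \<epsilon>"
  obtains \<beta> where "\<beta> \<in> actions G M" "finite (\<beta> ` carrier G)"
    "\<And>g A. g \<in> S \<Longrightarrow> A \<in> \<A> \<Longrightarrow>
       \<exists>T\<in>\<beta> g. measure M (sym_diff (T -` A \<inter> space M) (act \<alpha> g -` A \<inter> space M)) < \<epsilon>"
proof -
  interpret group G by fact
  interpret M: prob_space M using assms by (simp add: lebesgue_space_def)
  have sM: "standard_nonatomic M" by (rule lebesgue_space_standard_nonatomic) fact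
  have "\<forall>\<^sub>F n in sequentially. \<forall>g\<in>S.
      real (card (sym_diff (inv g <#\<^bsub>G\<^esub> F n) (F n))) / real (card (F n)) < \<epsilon>"
  proof (rule eventually_ball_finite[OF S(1)], rule ballI)
    fix g assume "g \<in> S"
    then have "inv g \<in> carrier G" using S by auto
    with assms(3) have "(\<lambda>n. real (card (sym_diff (inv g <#\<^bsub>G\<^esub> F n) (F n))) / real (card (F n))) \<longlonglongrightarrow> 0"
      unfolding folner_sequence_def by blast
    then show "\<forall>\<^sub>F n in sequentially. real (card (sym_diff (inv g <#\<^bsub>G\<^esub> F n) (F n))) / real (card (F n)) < \<epsilon>"
      by (rule order_tendstoD(2)) fact
  qed
  then obtain n where n: "\<forall>g\<in>S. real (card (sym_diff (inv g <#\<^bsub>G\<^esub> F n) (F n))) / real (card (F n)) < \<epsilon>"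
    using eventually_happens'[OF sequentially_bot] by blast
  have Fn: "finite (F n)" "F n \<noteq> {}" "F n \<subseteq> carrier G"
    using assms(3) by (auto simp: folner_sequence_def)
  obtain \<Omega> :: "(('g \<Rightarrow> 'g set) \<Rightarrow> nat) set" and \<tau> f where
    \<Omega>: "finite \<Omega>" "\<Omega> \<noteq> {}" and
    \<tau>: "\<forall>g\<in>carrier G. bij_betw (\<tau> g) \<Omega> \<Omega>"
      "\<forall>g\<in>carrier G. \<forall>h\<in>carrier G. \<forall>v\<in>\<Omega>. \<tau> (g \<otimes> h) v = \<tau> g (\<tau> h v)" and
    f: "\<forall>v\<in>\<Omega>. f v \<in> F n" and
    bad: "\<forall>g\<in>S. card {v \<in> \<Omega>. f (\<tau> g v) \<noteq> g \<otimes> f v} * card (F n)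
        \<le> card (sym_diff (inv g <#\<^bsub>G\<^esub> F n) (F n)) * card \<Omega>"
    by (rule almost_equivariant_map[OF assms(1,2) Fn S])
  note \<tau>bij = bspec[OF \<tau>(1)] and \<tau>mult = bspec[OF bspec[OF bspec[OF \<tau>(2)]]]
  define U where "U = uniform_count_measure \<Omega>"
  define P where "P = U \<Otimes>\<^sub>M M"
  have spU: "space U = \<Omega>" by (simp add: U_def space_uniform_count_measure)
  interpret U: prob_space U unfolding U_def by (rule prob_space_uniform_count_measure[OF \<Omega>])
  interpret P: pair_prob_space U M ..
  have sP: "standard_nonatomic P"
    unfolding P_def U_def by (rule standard_nonatomic_uniform_count_pair[OF \<Omega> sM])
  have fG: "f v \<in> carrier G" if "v \<in> \<Omega>" for v using f that Fn by auto
  define T where "T g = act \<alpha> g" for g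
  have T: "T g \<in> M \<rightarrow>\<^sub>M M" "distr M M (T g) = M" if "g \<in> carrier G" for g
    using invertible_mptD[OF act_invertible[OF \<alpha> that]] by (simp_all add: T_def)
  define \<pi> where "\<pi> z = T (f (fst z)) (snd z)" for z
  have \<pi>: "\<pi> \<in> P \<rightarrow>\<^sub>M M" "distr P M \<pi> = M"
    unfolding \<pi>_def[abs_def] P_def U_def
    by (rule measurable_uniform_count_pair[OF \<Omega>(1)], rule T[OF fG], assumption)
       (rule distr_uniform_count_pair[OF \<Omega> M.prob_space_axioms], (rule T[OF fG], assumption)+)
  have snd: "snd \<in> P \<rightarrow>\<^sub>M M" "distr P M snd = M"
    unfolding P_def by (measurable, unfold U_def)
      (rule distr_uniform_count_pair[OF \<Omega> M.prob_space_axioms, of "\<lambda>v x. x" M], simp_all add: distr_id2)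
  define H where "H r z = (r (fst z), snd z)" for r :: "(('g \<Rightarrow> 'g set) \<Rightarrow> nat) \<Rightarrow> ('g \<Rightarrow> 'g set) \<Rightarrow> nat"
    and z :: "(('g \<Rightarrow> 'g set) \<Rightarrow> nat) \<times> 'a"
  have Hm: "H r \<in> P \<rightarrow>\<^sub>M P" if "r \<in> \<Omega> \<rightarrow> \<Omega>" for r
  proof -
    have r: "r \<in> U \<rightarrow>\<^sub>M U"
      unfolding U_def by (rule measurable_uniform_count) fact
    show ?thesis
      unfolding H_def[abs_def] P_def
      by (intro measurable_Pair measurable_compose[OF measurable_fst r] measurable_snd)
  qed
  have dH: "distr P P (H r) = P" if r: "bij_betw r \<Omega> \<Omega>" for r
  proof -
    have rm: "r \<in> U \<rightarrow>\<^sub>M U"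
      unfolding U_def by (rule measurable_uniform_count) (use bij_betwE[OF r] in auto)
    have "distr U U r = U"
    proof (rule measure_eqI)
      fix X assume "X \<in> sets (distr U U r)"
      then have X: "X \<subseteq> \<Omega>" by (simp add: U_def sets_uniform_count_measure)
      have "\<forall>x\<in>X. \<exists>y\<in>\<Omega>. r y = x" using X bij_betw_imp_surj_on[OF r] by (metis imageE subsetD)
      then have "r ` (r -` X \<inter> \<Omega>) = X" by force
      moreover have "inj_on r (r -` X \<inter> \<Omega>)" using r by (auto simp: bij_betw_def intro: inj_on_subset)
      ultimately have "card (r -` X \<inter> \<Omega>) = card X" by (metis card_image)
      then show "emeasure (distr U U r) X = emeasure U X"
        using X by (subst emeasure_distr[OF rm])
          (simp_all add: U_def sets_uniform_count_measure space_uniform_count_measure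
            emeasure_uniform_count_measure \<Omega>)
    qed simp
    moreover have "distr M M (\<lambda>x. x) = M" by (rule distr_id2) simp
    ultimately have "P = distr U U r \<Otimes>\<^sub>M distr M M (\<lambda>x. x)" by (simp add: P_def)
    also have "\<dots> = distr P P (\<lambda>(x, y). (r x, y))"
      unfolding P_def by (rule pair_measure_distr[OF rm]) (simp_all add: distr_id2 M.sigma_finite_measure_axioms)
    finally have "distr P P (\<lambda>(x, y). (r x, y)) = P" by (rule sym)
    then show ?thesis by (simp add: H_def[abs_def] case_prod_beta')
  qed
  \<comment> \<open>The final comparison uses label preservation twice: for \<open>A\<close> at the
    image point, and for the preimage of \<open>A\<close> under \<open>T g\<close> at the point
    itself.\<close>
  define \<A>' where "\<A>' = \<A> \<union> (\<lambda>(g, A). T g -` A \<inter> space M) ` (S \<times> \<A>)"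
  have \<A>': "finite \<A>'" "\<A>' \<subseteq> sets M"
    using S \<A> measurable_sets[OF T(1)] by (auto simp: \<A>'_def)
  obtain \<theta> \<theta>' where \<theta>: "\<theta> \<in> M \<rightarrow>\<^sub>M P" "\<theta>' \<in> P \<rightarrow>\<^sub>M M" "distr M P \<theta> = P" "distr P M \<theta>' = M"
    and inv: "AE x in M. \<theta>' (\<theta> x) = x" "AE z in P. \<theta> (\<theta>' z) = z"
    and lab: "\<And>A. A \<in> \<A>' \<Longrightarrow> AE x in M. \<pi> (\<theta> x) \<in> A \<longleftrightarrow> x \<in> A"
    by (rule standard_nonatomic_isomorphism_sets[OF sM sP \<pi> \<A>']) blast
  define B where "B r = \<theta>' \<circ> H r \<circ> \<theta>" for r
  \<comment> \<open>Restriction to \<open>\<Omega>\<close> makes \<open>\<sigma> g\<close> one of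
    finitely many functions.\<close>
  define \<sigma> where "\<sigma> g = restrict (\<tau> g) \<Omega>" for g
  have \<sigma>: "bij_betw (\<sigma> g) \<Omega> \<Omega>" "\<sigma> g \<in> \<Omega> \<rightarrow> \<Omega>" if "g \<in> carrier G" for g
    using \<tau>bij[OF that] bij_betwE[OF \<tau>bij[OF that]] by (auto simp: \<sigma>_def)
  have B: "B (\<sigma> g) \<in> M \<rightarrow>\<^sub>M M" "distr M M (B (\<sigma> g)) = M" if "g \<in> carrier G" for g
  proof -
    note Hg = Hm[OF \<sigma>(2)[OF that]]
    show "B (\<sigma> g) \<in> M \<rightarrow>\<^sub>M M"
      unfolding B_def by (intro measurable_comp[OF \<theta>(1)] measurable_comp[OF Hg] \<theta>(2))
    have "distr M M (B (\<sigma> g)) = distr (distr (distr M P \<theta>) P (H (\<sigma> g))) M \<theta>'"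
      unfolding B_def using \<theta> Hg
      by (subst distr_distr, simp, simp, subst distr_distr) (simp_all add: comp_assoc measurable_comp[OF Hg])
    then show "distr M M (B (\<sigma> g)) = M" by (simp add: \<theta> dH[OF \<sigma>(1)[OF that]])
  qed
  \<comment> \<open>\<open>\<theta>'\<close> inverts \<open>\<theta>\<close> only off a null set,
    which is pulled back along the measure-preserving maps \<open>H (\<sigma> g)\<close> and
    \<open>\<theta>\<close>.\<close>
  have \<theta>H: "AE x in M. \<theta> (B (\<sigma> g) x) = H (\<sigma> g) (\<theta> x)" if "g \<in> carrier G" for g
    using AE_pullback[OF \<theta>(1,3) AE_pullback[OF Hm[OF \<sigma>(2)[OF that]] dH[OF \<sigma>(1)[OF that]] inv(2)]]
    by (simp add: B_def)
  have sp\<theta>: "fst (\<theta> x) \<in> \<Omega>" if "x \<in> space M" for x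
    using measurable_space[OF \<theta>(1) that] by (auto simp: P_def space_pair_measure spU)
  have Bmult: "AE x in M. B (\<sigma> (g \<otimes> h)) x = B (\<sigma> g) (B (\<sigma> h) x)" if g: "g \<in> carrier G" "h \<in> carrier G" for g h
    using \<theta>H[OF g(2)] AE_space
  proof eventually_elim
    case (elim x)
    have "\<sigma> (g \<otimes> h) (fst (\<theta> x)) = \<sigma> g (\<sigma> h (fst (\<theta> x)))"
      using sp\<theta>[OF elim(2)] \<tau>mult[OF g] bij_betwE[OF \<tau>bij[OF g(2)]] by (simp add: \<sigma>_def)
    then show ?case using elim(1) by (simp add: B_def H_def)
  qed
  have Bone: "AE x in M. B (\<sigma> \<one>) x = x"
    using inv(1) AE_space
  proof eventually_elim
    case (elim x)
    let ?v = "fst (\<theta> x)"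
    have v: "?v \<in> \<Omega>" by (rule sp\<theta>[OF elim(2)])
    \<comment> \<open>A bijection equal to its own square is the identity, so the unit law follows
      from multiplicativity.\<close>
    have "\<tau> \<one> ?v = \<tau> \<one> (\<tau> \<one> ?v)" using \<tau>mult[of \<one> \<one> ?v] v by simp
    then have "\<tau> \<one> ?v = ?v"
      using \<tau>bij[of \<one>] v bij_betwE[OF \<tau>bij[of \<one>]] by (metis bij_betw_inv_into_left one_closed)
    then show ?case using elim(1) v by (simp add: B_def H_def \<sigma>_def)
  qed
  have Binv: "B (\<sigma> g) \<in> invertible_mpt M" if g: "g \<in> carrier G" for g
  proof (rule invertible_mptI)
    show "AE x in M. B (\<sigma> (inv g)) (B (\<sigma> g) x) = x"
      using Bmult[of "inv g" g] Bone g by (auto elim: eventually_elim2)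
    show "AE x in M. B (\<sigma> g) (B (\<sigma> (inv g)) x) = x"
      using Bmult[of g "inv g"] Bone g by (auto elim: eventually_elim2)
  qed (use B g in auto)
  define \<beta> where "\<beta> = (\<lambda>g\<in>carrier G. ae_class M (B (\<sigma> g)))"
  have \<sigma>E: "\<sigma> g \<in> \<Omega> \<rightarrow>\<^sub>E \<Omega>" if "g \<in> carrier G" for g
    using \<sigma>(2)[OF that] by (simp add: PiE_def) (simp add: \<sigma>_def)
  have "\<beta> \<in> actions G M"
  proof -
    have "\<beta> (g \<otimes> h) = \<beta> g \<otimes>\<^bsub>Aut M\<^esub> \<beta> h" if g: "g \<in> carrier G" "h \<in> carrier G" for g h
    proof -
      have "\<beta> g \<otimes>\<^bsub>Aut M\<^esub> \<beta> h = ae_class M (B (\<sigma> g) \<circ> B (\<sigma> h))"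
        using g by (simp add: \<beta>_def Aut_mult Binv)
      also have "\<dots> = ae_class M (B (\<sigma> (g \<otimes> h)))"
        using Bmult[OF g] g
        by (intro ae_class_eq invertible_mpt_comp Binv) (auto elim: eventually_mono)
      finally show ?thesis using g by (simp add: \<beta>_def)
    qed
    then show ?thesis
      by (auto simp: actions_def hom_def \<beta>_def ae_class_in_Aut Binv)
  qed
  moreover have "finite (\<beta> ` carrier G)"
  proof (rule finite_subset)
    show "\<beta> ` carrier G \<subseteq> (\<lambda>r. ae_class M (B r)) ` (\<Omega> \<rightarrow>\<^sub>E \<Omega>)"
      using \<sigma>E by (auto simp: \<beta>_def)
    show "finite ((\<lambda>r. ae_class M (B r)) ` (\<Omega> \<rightarrow>\<^sub>E \<Omega>))"
      by (intro finite_imageI finite_PiE \<Omega>)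
  qed
  moreover have "\<exists>R\<in>\<beta> g. measure M (sym_diff (R -` A \<inter> space M) (act \<alpha> g -` A \<inter> space M)) < \<epsilon>"
    if g: "g \<in> S" and A: "A \<in> \<A>" for g A
  proof
    have gG: "g \<in> carrier G" using g S by auto
    show "B (\<sigma> g) \<in> \<beta> g" using gG by (simp add: \<beta>_def ae_equal_def Binv)
    define Z where "Z = {v \<in> \<Omega>. f (\<tau> g v) \<noteq> g \<otimes> f v}"
    have ZU: "Z \<in> sets U" by (auto simp: Z_def U_def sets_uniform_count_measure)
    have AM: "A \<in> sets M" using A \<A> by auto
    \<comment> \<open>The action law has a null set of exceptions for each pair; as
      \<open>\<Omega>\<close> is finite, one null set serves all \<open>f v\<close>.\<close>
    have eq: "AE x in M. \<forall>v\<in>\<Omega>. T (g \<otimes> f v) x = T g (T (f v) x)"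
      using act_mult[OF \<alpha> gG] gG fG by (intro AE_finite_allI \<Omega>) (simp add: T_def)
    have 1: "AE x in M. \<pi> (\<theta> (B (\<sigma> g) x)) \<in> A \<longleftrightarrow> B (\<sigma> g) x \<in> A"
      by (rule AE_pullback[OF B[OF gG] lab]) (simp add: \<A>'_def A)
    have 2: "AE x in M. \<pi> (\<theta> x) \<in> T g -` A \<inter> space M \<longleftrightarrow> x \<in> T g -` A \<inter> space M"
      by (rule lab) (use g A in \<open>auto simp: \<A>'_def\<close>)
    have 3: "AE x in M. \<forall>v\<in>\<Omega>. T (g \<otimes> f v) (snd (\<theta> x)) = T g (T (f v) (snd (\<theta> x)))"
      by (rule AE_pullback[OF \<theta>(1,3) AE_pullback[OF snd eq]])
    \<comment> \<open>If the first coordinate of \<open>\<theta> x\<close> is outside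
      \<open>Z\<close>, then \<open>\<pi>\<close> intertwines the two maps there, and by the label
      identities \<open>x\<close> lies in both preimages of \<open>A\<close> or in neither.\<close>
    have "AE x in M. x \<in> sym_diff (B (\<sigma> g) -` A \<inter> space M) (T g -` A \<inter> space M)
        \<longrightarrow> x \<in> \<theta> -` (Z \<times> space M) \<inter> space M"
      using 1 2 3 \<theta>H[OF gG] AE_space
    proof eventually_elim
      case (elim x)
      let ?v = "fst (\<theta> x)"
      have v: "?v \<in> \<Omega>" by (rule sp\<theta>[OF elim(5)])
      have sx: "snd (\<theta> x) \<in> space M" using measurable_space[OF \<theta>(1) elim(5)] by (auto simp: P_def space_pair_measure)
      have px: "\<pi> (\<theta> x) \<in> space M" using measurable_space[OF \<pi>(1) measurable_space[OF \<theta>(1) elim(5)]] .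
      show ?case
      proof (cases "?v \<in> Z")
        case True
        then show ?thesis using elim(5) sx by (simp add: mem_Times_iff)
      next
        case False
        then have "\<pi> (H (\<sigma> g) (\<theta> x)) = T g (\<pi> (\<theta> x))"
          using v elim(3) by (simp add: \<pi>_def H_def \<sigma>_def Z_def)
        then have "B (\<sigma> g) x \<in> A \<longleftrightarrow> T g x \<in> A"
          using elim px by simp
        then show ?thesis by auto
      qed
    qed
    then have "measure M (sym_diff (B (\<sigma> g) -` A \<inter> space M) (T g -` A \<inter> space M))
        \<le> measure M (\<theta> -` (Z \<times> space M) \<inter> space M)"
      using measurable_sets[OF \<theta>(1)] ZU by (intro M.finite_measure_mono_AE) (auto simp: P_def)
    also have "\<dots> = measure P (Z \<times> space M)"
      by (rule measure_pullback[OF \<theta>(1,3)]) (use ZU in \<open>auto simp: P_def\<close>)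
    also have "\<dots> = measure U Z"
      using ZU by (simp add: measure_def P_def M.emeasure_pair_measure_Times M.emeasure_space_1)
    also have "\<dots> = real (card Z) / real (card \<Omega>)"
      unfolding U_def by (rule measure_uniform_count_measure[OF \<Omega>(1)]) (auto simp: Z_def)
    also have "\<dots> \<le> real (card (sym_diff (inv g <#\<^bsub>G\<^esub> F n) (F n))) / real (card (F n))"
    proof -
      have "real (card Z) * real (card (F n)) \<le> real (card (sym_diff (inv g <#\<^bsub>G\<^esub> F n) (F n))) * real (card \<Omega>)"
        unfolding of_nat_mult[symmetric] of_nat_le_iff Z_def by (rule bspec[OF bad g])
      then show ?thesis using \<Omega> Fn by (simp add: divide_simps card_gt_0_iff mult.commute)
    qed
    also have "\<dots> < \<epsilon>" using n g by blast
    finally show "measure M (sym_diff (B (\<sigma> g) -` A \<inter> space M) (act \<alpha> g -` A \<inter> space M)) < \<epsilon>"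
      by (simp add: T_def)
  qed
  ultimately show ?thesis by (rule that)
qed

section \<open>Entropy of admissible semimetrics\<close>

text \<open>Being in the same cell of the partition generated by the first \<open>k\<close>
  sets.\<close>

definition agree :: "(nat \<Rightarrow> 'a set) \<Rightarrow> nat \<Rightarrow> 'a \<Rightarrow> 'a \<Rightarrow> bool" where
  "agree U k x y \<longleftrightarrow> (\<forall>j<k. x \<in> U j \<longleftrightarrow> y \<in> U j)"

lemma agree_mono: "agree U k x y \<Longrightarrow> k' \<le> k \<Longrightarrow> agree U k' x y"
  by (auto simp: agree_def)

lemma borel_countably_generated:
  obtains U :: "nat \<Rightarrow> 'a::second_countable_topology set" where "sets borel = sigma_sets UNIV (range U)"
proof -
  obtain B :: "'a set set" where B: "countable B" "topological_basis B"
    using ex_countable_basis by blast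
  have ne: "B \<noteq> {}" using topological_basis_imp_subbasis[OF B(2)] B(2)
    by (metis Union_empty empty_iff open_UNIV subset_empty topological_basis_def UNIV_I)
  have "borel = sigma UNIV (range (from_nat_into B))"
    using borel_eq_countable_basis[OF B] range_from_nat_into[OF ne B(1)] by simp
  then have "sets borel = sets (sigma UNIV (range (from_nat_into B)))" by (rule arg_cong)
  then show ?thesis by (intro that[of "from_nat_into B"]) simp
qed

text \<open>Unions of cells are dense in the measure algebra: the sets they approximate include the
  generators and are closed under complements, and a countable union is first cut to a finite
  one.\<close>

lemma approx_by_saturated:
  assumes "finite_measure M" and gen: "sets M = sigma_sets (space M) (range U)" and "A \<in> sets M" "0 < e"
  shows "\<exists>k W. W \<in> sets M \<and> (\<forall>x\<in>space M. \<forall>y\<in>space M. agree U k x y \<longrightarrow> (x \<in> W \<longleftrightarrow> y \<in> W)) \<and>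
    measure M (sym_diff A W) < e"
proof -
  interpret finite_measure M by fact
  have Us: "U j \<in> sets M" for j unfolding gen by (rule sigma_sets.Basic) simp
  from assms(3) have "A \<in> sigma_sets (space M) (range U)" by (simp add: gen)
  then show ?thesis using \<open>0 < e\<close>
  proof (induction arbitrary: e)
    case (Basic A)
    then obtain j where "A = U j" by auto
    then show ?case using Basic.prems Us
      by (intro exI[of _ "Suc j"] exI[of _ A]) (auto simp: agree_def)
  next
    case Empty
    then show ?case by (intro exI[of _ 0] exI[of _ "{}"]) auto
  next
    case (Compl A)
    then obtain k W where W: "W \<in> sets M" "\<forall>x\<in>space M. \<forall>y\<in>space M. agree U k x y \<longrightarrow> (x \<in> W \<longleftrightarrow> y \<in> W)"
      "measure M (sym_diff A W) < e" using Compl.IH[OF Compl.prems] by (elim exE conjE)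
    have "A \<subseteq> space M" "W \<subseteq> space M"
      using Compl.hyps gen W(1) sets.sets_into_space by (metis, metis)
    then have "sym_diff (space M - A) (space M - W) = sym_diff A W" by auto
    then show ?case using W by (intro exI[of _ k] exI[of _ "space M - W"]) auto
  next
    case (Union A)
    have As: "A i \<in> sets M" for i using Union.hyps by (simp add: gen)
    define L where "L n = (\<Union>i<n. A i)" for n
    have Ls: "L n \<in> sets M" for n using As by (auto simp: L_def)
    have "(\<lambda>n. measure M (L n)) \<longlonglongrightarrow> measure M (\<Union>n. L n)"
      by (rule finite_Lim_measure_incseq) (use Ls in \<open>force simp: L_def incseq_def\<close>)+
    also have "(\<Union>n. L n) = (\<Union>i. A i)" by (auto simp: L_def)
    finally have "\<forall>\<^sub>F n in sequentially. measure M (\<Union>i. A i) - e / 2 < measure M (L n)"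
      by (rule order_tendstoD(1)) (use Union.prems in simp)
    then obtain n where n: "measure M (\<Union>i. A i) - e / 2 < measure M (L n)"
      using eventually_happens'[OF sequentially_bot] by blast
    \<comment> \<open>Half of \<open>e\<close> pays for cutting the union, the other half is shared
      by \<open>n\<close> sets; the added 1 covers \<open>n = 0\<close>.\<close>
    define d where "d = e / (2 * (real n + 1))"
    have d: "0 < d" using Union.prems by (simp add: d_def)
    have "\<forall>i. \<exists>k W. W \<in> sets M \<and> (\<forall>x\<in>space M. \<forall>y\<in>space M. agree U k x y \<longrightarrow> (x \<in> W \<longleftrightarrow> y \<in> W)) \<and>
      measure M (sym_diff (A i) W) < d" using Union.IH d by blast
    then obtain k W where W: "\<And>i. W i \<in> sets M"
      "\<And>i x y. x \<in> space M \<Longrightarrow> y \<in> space M \<Longrightarrow> agree U (k i) x y \<Longrightarrow> (x \<in> W i \<longleftrightarrow> y \<in> W i)"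
      "\<And>i. measure M (sym_diff (A i) (W i)) < d" by metis
    define V where "V = (\<Union>i<n. W i)"
    define m where "m = Max (insert 0 (k ` {..<n}))"
    have km: "k i \<le> m" if "i < n" for i using that by (auto simp: m_def intro!: Max_ge)
    have "x \<in> V \<longleftrightarrow> y \<in> V" if "x \<in> space M" "y \<in> space M" "agree U m x y" for x y
      using W(2)[OF that(1,2) agree_mono[OF that(3) km]] by (auto simp: V_def)
    moreover have Vs: "V \<in> sets M" using W by (auto simp: V_def)
    moreover have "measure M (sym_diff (\<Union>i. A i) V) < e"
    proof -
      have "sym_diff (\<Union>i. A i) V \<subseteq> ((\<Union>i. A i) - L n) \<union> (\<Union>i<n. sym_diff (A i) (W i))"
        by (auto simp: V_def L_def)
      then have "measure M (sym_diff (\<Union>i. A i) V)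
          \<le> measure M (((\<Union>i. A i) - L n) \<union> (\<Union>i<n. sym_diff (A i) (W i)))"
        using As W Ls by (intro finite_measure_mono) auto
      also have "\<dots> \<le> measure M ((\<Union>i. A i) - L n) + measure M (\<Union>i<n. sym_diff (A i) (W i))"
        using As W Ls by (intro measure_Un_le) auto
      also have "measure M ((\<Union>i. A i) - L n) = measure M (\<Union>i. A i) - measure M (L n)"
        using As Ls by (intro finite_measure_Diff) (auto simp: L_def)
      also have "measure M (\<Union>i<n. sym_diff (A i) (W i)) \<le> (\<Sum>i<n. measure M (sym_diff (A i) (W i)))"
        using As W by (intro measure_UNION_le) auto
      also have "\<dots> \<le> (\<Sum>i<n. d)" by (intro sum_mono less_imp_le W)
      also have "(\<Sum>i<n. d) \<le> e / 2"
        using Union.prems by (simp add: d_def field_simps)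
      finally show ?thesis using n by linarith
    qed
    ultimately show ?case by blast
  qed
qed

text \<open>Finitely many balls of radius \<open>\<delta> / 2\<close> cover most of the space and
  are nearly unions of cells, so two points of one cell are \<open>\<delta>\<close>-close unless one
  is exceptional. As \<open>\<rho>\<close> may be unbounded, exceptional points are paid for by
  \<open>f\<close>, built from the distance to a fixed point.\<close>

lemma admissible_semimetric_bound:
  fixes M :: "'a::polish_space measure"
  assumes "prob_space M" "sets M = sets borel" and gen: "sets M = sigma_sets (space M) (range U)"
    and "\<rho> \<in> Adm M" "0 < \<delta>" "0 < \<eta>"
  obtains k f where "integrable M f" "(\<integral>x. f x \<partial>M) < \<eta>" "\<And>x. 0 \<le> f x"
    "\<And>x y. agree U k x y \<Longrightarrow> \<rho> x y \<le> \<delta> + f x + f y"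
proof -
  interpret M: prob_space M by fact
  interpret MM: pair_sigma_finite M M ..
  have sp: "space M = UNIV" using assms(2) by (simp add: sets_eq_imp_space_eq)
  have adm: "admissible M \<rho>" and int: "integrable (M \<Otimes>\<^sub>M M) (\<lambda>(x, y). \<rho> x y)"
    using assms(4) by (auto simp: Adm_def)
  then have "(\<lambda>(x, y). \<rho> x y) \<in> borel_measurable (M \<Otimes>\<^sub>M M)"
    and nonneg: "\<And>x y. 0 \<le> \<rho> x y" and sym: "\<And>x y. \<rho> x y = \<rho> y x"
    and tri: "\<And>x y z. \<rho> x z \<le> \<rho> x y + \<rho> y z"
    by (auto simp: admissible_def measurable_semimetric_def sp)
  then have meas[measurable]: "(\<lambda>x. \<rho> x d) \<in> borel_measurable M" for d
    using measurable_compose[of "\<lambda>x. (x, d)" M "M \<Otimes>\<^sub>M M" "\<lambda>(x, y). \<rho> x y" borel] by (simp add: sp)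
  \<comment> \<open>Fubini provides a base point from which the distance is integrable.\<close>
  have "AE x in M. integrable M (\<lambda>y. \<rho> x y)"
    using MM.AE_integrable_fst'[OF int] by simp
  then obtain x0 where x0: "integrable M (\<lambda>y. \<rho> x0 y)"
    using eventually_happens'[OF M.ae_filter_bot] by blast
  define u where "u x = \<rho> x0 x" for x
  have u[measurable]: "u \<in> borel_measurable M" and intu: "integrable M u" and u0: "0 \<le> u x" for x
    using x0 nonneg by (auto simp: u_def[abs_def])
  have "(\<lambda>n. \<integral>x. indicator {x. real n < u x} x * u x \<partial>M) \<longlonglongrightarrow> (\<integral>x. 0 \<partial>M)"
  proof (rule integral_dominated_convergence[where w = u])
    show "AE x in M. (\<lambda>n. indicator {x. real n < u x} x * u x) \<longlonglongrightarrow> 0"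
    proof (rule AE_I2)
      fix x
      have "\<forall>\<^sub>F n in sequentially. indicator {x. real n < u x} x * u x = 0"
        using eventually_ge_at_top[of "nat \<lceil>u x\<rceil>"]
        proof eventually_elim
          case (elim n)
          then have "u x \<le> real n" by linarith
          then show ?case by (simp add: indicator_def)
        qed
      then show "(\<lambda>n. indicator {x. real n < u x} x * u x) \<longlonglongrightarrow> 0"
        by (rule tendsto_eventually)
    qed
    show "AE x in M. norm (indicator {x. real n < u x} x * u x) \<le> u x" for n
      using u0 by (auto simp: indicator_def)
  qed (use intu in auto)
  then have "\<forall>\<^sub>F n in sequentially. (\<integral>x. indicator {x. real n < u x} x * u x \<partial>M) < \<eta> / 8"
    using assms by (intro order_tendstoD(2)) auto
  then obtain N where N: "(\<integral>x. indicator {x. real N < u x} x * u x \<partial>M) < \<eta> / 8"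
    using eventually_happens'[OF sequentially_bot] by blast
  define R where "R = real N"
  have R0: "0 \<le> R" by (simp add: R_def)
  \<comment> \<open>Chosen so that the term \<open>2 * R * (2 * \<zeta>)\<close> in the integral of
    \<open>f\<close> is at most \<open>\<eta> / 2\<close>.\<close>
  define \<zeta> where "\<zeta> = \<eta> / (8 * (R + 1))"
  have \<zeta>: "0 < \<zeta>" using assms R0 by (simp add: \<zeta>_def)
  obtain Y D where Y: "Y \<in> sets M" "measure M Y = 1" and D: "countable D" "\<forall>x\<in>Y. \<forall>e>0. \<exists>d\<in>D. \<rho> x d < e"
    using adm unfolding admissible_def by blast
  have "Y \<noteq> {}" using Y by auto
  then have "D \<noteq> {}" using D(2) by (meson all_not_in_conv zero_less_one)
  define B where "B i = {x. \<rho> x (from_nat_into D i) < \<delta> / 2}" for i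
  have B[measurable]: "B i \<in> sets M" for i
  proof -
    have "{x \<in> space M. \<rho> x (from_nat_into D i) < \<delta> / 2} \<in> sets M" by measurable
    then show ?thesis by (simp add: B_def sp)
  qed
  have YB: "Y \<subseteq> (\<Union>i. B i)"
  proof
    fix x assume "x \<in> Y"
    then obtain d where "d \<in> D" "\<rho> x d < \<delta> / 2" using D(2) assms by (meson half_gt_zero)
    then show "x \<in> (\<Union>i. B i)"
      using from_nat_into_surj[OF D(1)] by (force simp: B_def)
  qed
  define L where "L p = (\<Union>i<p. B i)" for p
  have L[measurable]: "L p \<in> sets M" for p by (auto simp: L_def)
  have "(\<lambda>p. measure M (L p)) \<longlonglongrightarrow> measure M (\<Union>p. L p)"
    by (rule M.finite_Lim_measure_incseq) (force simp: L_def incseq_def)+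
  also have "measure M (\<Union>p. L p) = 1"
  proof (rule antisym)
    have "Y \<subseteq> (\<Union>p. L p)" using YB by (force simp: L_def)
    then show "1 \<le> measure M (\<Union>p. L p)" using Y(2) M.finite_measure_mono[of Y "\<Union>p. L p"] by auto
  qed simp
  finally have "\<forall>\<^sub>F p in sequentially. 1 - \<zeta> < measure M (L p)"
    by (rule order_tendstoD(1)) (use \<zeta> in simp)
  then obtain p where p: "1 - \<zeta> < measure M (L p)"
    using eventually_happens'[OF sequentially_bot] by blast
  have "\<forall>i. \<exists>k W. W \<in> sets M \<and> (\<forall>x\<in>space M. \<forall>y\<in>space M. agree U k x y \<longrightarrow> (x \<in> W \<longleftrightarrow> y \<in> W)) \<and>
      measure M (sym_diff (B i) W) < \<zeta> / (real p + 1)"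
    using approx_by_saturated[OF M.finite_measure_axioms gen B] \<zeta> by simp
  then obtain k W where W[measurable]: "\<And>i. W i \<in> sets M" and
    W2: "\<And>i x y. agree U (k i) x y \<Longrightarrow> (x \<in> W i \<longleftrightarrow> y \<in> W i)" and
    W3: "\<And>i. measure M (sym_diff (B i) (W i)) < \<zeta> / (real p + 1)" unfolding sp by (metis UNIV_I)
  define m where "m = Max (insert 0 (k ` {..<p}))"
  have km: "k i \<le> m" if "i < p" for i using that by (auto simp: m_def intro!: Max_ge)
  define Z where "Z = (space M - L p) \<union> (\<Union>i<p. sym_diff (B i) (W i))"
  have Z[measurable]: "Z \<in> sets M" by (auto simp: Z_def)
  have mZ: "measure M Z \<le> 2 * \<zeta>"
  proof -
    have "measure M Z \<le> measure M (space M - L p) + measure M (\<Union>i<p. sym_diff (B i) (W i))"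
      unfolding Z_def by (intro measure_Un_le) auto
    also have "measure M (space M - L p) = 1 - measure M (L p)" by (rule M.prob_compl) simp
    also have "measure M (\<Union>i<p. sym_diff (B i) (W i)) \<le> (\<Sum>i<p. measure M (sym_diff (B i) (W i)))"
      by (intro measure_UNION_le) auto
    also have "\<dots> \<le> (\<Sum>i<p. \<zeta> / (real p + 1))" by (intro sum_mono less_imp_le W3)
    also have "\<dots> \<le> \<zeta>" using \<zeta> by (simp add: field_simps)
    finally show ?thesis using p by linarith
  qed
  \<comment> \<open>At an exceptional \<open>x\<close> the value \<open>f x\<close> is at least
    \<open>u x + R\<close>, which pays for \<open>u x\<close> and for \<open>u y\<close> when
    \<open>u y \<le> R\<close>. Otherwise \<open>y\<close> is exceptional too and pays for
    itself.\<close>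
  define f where "f x = 2 * (indicator {x. R < u x} x * u x) + 2 * R * indicator Z x" for x
  have "{x \<in> space M. R < u x} \<in> sets M" by measurable
  then have [measurable]: "{x. R < u x} \<in> sets M" by (simp add: sp)
  have int1: "integrable M (\<lambda>x. indicator {x. R < u x} x * u x)"
    using integrable_real_mult_indicator[OF _ intu] by (simp add: mult.commute)
  have int2: "integrable M (indicator Z :: 'a \<Rightarrow> real)" by (simp add: less_top[symmetric])
  have "integrable M f" unfolding f_def using int1 int2 by auto
  moreover have "(\<integral>x. f x \<partial>M) < \<eta>"
  proof -
    have "(\<integral>x. f x \<partial>M) = 2 * (\<integral>x. indicator {x. R < u x} x * u x \<partial>M) + 2 * R * measure M Z"
      unfolding f_def using int1 int2 by (subst Bochner_Integration.integral_add) auto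
    also have "\<dots> \<le> 2 * (\<eta> / 8) + 2 * R * (2 * \<zeta>)"
      using N mZ R0 by (intro add_mono mult_left_mono) (auto simp: R_def)
    also have "2 * R * (2 * \<zeta>) \<le> \<eta> / 2"
      using R0 assms by (simp add: \<zeta>_def field_simps)
    finally show ?thesis using assms by linarith
  qed
  moreover have f0: "0 \<le> f x" for x using u0 R0 by (simp add: f_def)
  moreover have "\<rho> x y \<le> \<delta> + f x + f y" if a: "agree U m x y" for x y
  proof -
    have bad: "u x + R \<le> f x" if "R < u x \<or> x \<in> Z" for x
      using that u0[of x] R0 by (auto simp: f_def indicator_def)
    have t: "\<rho> x y \<le> u x + u y" using tri[of x y x0] sym[of x x0] by (simp add: u_def)
    consider "R < u x \<or> x \<in> Z" | "R < u y \<or> y \<in> Z" | "u x \<le> R" "u y \<le> R" "x \<notin> Z" "y \<notin> Z" by linarith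
    then show ?thesis
    proof cases
      case 1
      then show ?thesis
        using t bad[of x] bad[of y] f0[of y] f0[of x] u0[of x] R0 assms by (cases "R < u y") auto
    next
      case 2
      then show ?thesis
        using t bad[of x] bad[of y] f0[of y] f0[of x] u0[of y] R0 assms by (cases "R < u x") auto
    next
      case 3
      then obtain i where i: "i < p" "x \<in> B i" by (auto simp: Z_def sp L_def)
      then have "x \<in> W i" using 3 by (auto simp: Z_def)
      then have "y \<in> W i" using W2[OF agree_mono[OF a km[OF i(1)]]] by simp
      then have "y \<in> B i" using 3 i by (auto simp: Z_def)
      let ?d = "from_nat_into D i"
      have "\<rho> x y \<le> \<rho> x ?d + \<rho> y ?d" using tri[of x y ?d] sym[of y ?d] by simp
      also have "\<dots> < \<delta>" using i(2) \<open>y \<in> B i\<close> by (simp add: B_def)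
      finally show ?thesis using f0[of x] f0[of y] by simp
    qed
  qed
  ultimately show ?thesis by (rule that)
qed

section \<open>Covers that serve all semimetrics\<close>

text \<open>Involves the action but no semimetric, so that a single set of actions can handle every
  \<open>\<rho>\<close>. One parameter \<open>k\<close> governs both the fineness of the partition
  and the size of the exceptional set, so countably many conditions suffice.\<close>

definition agreement_cover ::
    "'a measure \<Rightarrow> (nat \<Rightarrow> 'a set) \<Rightarrow> ('g \<Rightarrow> ('a \<Rightarrow> 'a) set) \<Rightarrow> 'g set \<Rightarrow> nat \<Rightarrow> nat \<Rightarrow> bool" where
  "agreement_cover M U \<beta> E k r \<longleftrightarrow>
     (\<exists>A :: nat \<Rightarrow> 'a set. (\<forall>i\<le>r. A i \<in> sets M) \<and> space M = (\<Union>i\<le>r. A i) \<and>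
        measure M (A 0) < 1 / (real k + 1) \<and>
        (\<forall>i\<in>{1..r}. \<forall>x\<in>A i. \<forall>y\<in>A i. \<forall>g\<in>E. agree U k (act \<beta> g x) (act \<beta> g y)))"

text \<open>On a common piece the averaged semimetric is at most
  \<open>\<epsilon> / 4 + h x + h y\<close>, where \<open>h\<close> averages \<open>f\<close> along
  \<open>E\<close>. By invariance \<open>h\<close> has the integral of \<open>f\<close>, so Markov's
  inequality allows the points with large \<open>h\<close> to join the exceptional set. The estimate
  is uniform in the action and in \<open>E\<close>, hence \<open>k0\<close> can be fixed before
  them.\<close>

lemma agreement_cover_imp_eps_cover:
  fixes M :: "'a::polish_space measure" and U :: "nat \<Rightarrow> 'a set"
  assumes "prob_space M" "sets M = sets borel" "sets M = sigma_sets (space M) (range U)"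
    and "\<rho> \<in> Adm M" "0 < \<epsilon>"
  obtains k0 where "\<And>\<beta> (G :: ('g, 'r) monoid_scheme) E k r. \<beta> \<in> actions G M \<Longrightarrow> E \<subseteq> carrier G \<Longrightarrow> finite E \<Longrightarrow> E \<noteq> {} \<Longrightarrow>
      k0 \<le> k \<Longrightarrow> agreement_cover M U \<beta> E k r \<Longrightarrow> eps_cover M (average \<beta> E \<rho>) \<epsilon> r"
proof -
  interpret M: prob_space M by fact
  have sp: "space M = UNIV" using assms(2) by (simp add: sets_eq_imp_space_eq)
  \<comment> \<open>Markov's inequality at level \<open>\<epsilon> / 8\<close> turns the integral
    bound \<open>\<epsilon>\<^sup>2 / 16\<close> into measure below \<open>\<epsilon> / 2\<close>;
    the other half is left for \<open>A 0\<close>.\<close>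
  have "0 < \<epsilon> / 4" "0 < \<epsilon>\<^sup>2 / 16" using assms by auto
  then obtain k1 f where f: "integrable M f" "(\<integral>x. f x \<partial>M) < \<epsilon>\<^sup>2 / 16" "\<And>x. 0 \<le> f x"
    "\<And>x y. agree U k1 x y \<Longrightarrow> \<rho> x y \<le> \<epsilon> / 4 + f x + f y"
    using admissible_semimetric_bound[OF assms(1-4)] by metis
  define k0 where "k0 = max k1 (nat \<lceil>2 / \<epsilon>\<rceil>)"
  show ?thesis
  proof (rule that[of k0])
    fix \<beta> E k r and G :: "('g, 'r) monoid_scheme"
    assume \<beta>: "\<beta> \<in> actions G M" and E: "E \<subseteq> carrier G" "finite E" "E \<noteq> {}"
      and k: "k0 \<le> k" and "agreement_cover M U \<beta> E k r"
    then obtain A :: "nat \<Rightarrow> 'a set" where A: "\<forall>i\<le>r. A i \<in> sets M" "space M = (\<Union>i\<le>r. A i)"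
        "measure M (A 0) < 1 / (real k + 1)"
        "\<forall>i\<in>{1..r}. \<forall>x\<in>A i. \<forall>y\<in>A i. \<forall>g\<in>E. agree U k (act \<beta> g x) (act \<beta> g y)"
      unfolding agreement_cover_def by blast
    define N where "N = real (card E)"
    have N: "0 < N" using E by (simp add: N_def card_gt_0_iff)
    define h where "h x = (\<Sum>g\<in>E. f (act \<beta> g x)) / N" for x
    have T: "act \<beta> g \<in> M \<rightarrow>\<^sub>M M" "distr M M (act \<beta> g) = M" if "g \<in> E" for g
      using invertible_mptD[OF act_invertible[OF \<beta>]] that E by auto
    have fT: "integrable M (\<lambda>x. f (act \<beta> g x))" "(\<integral>x. f (act \<beta> g x) \<partial>M) = (\<integral>x. f x \<partial>M)" if "g \<in> E" for g
      using integrable_distr[OF T(1)[OF that], of f] integral_distr[OF T(1)[OF that], of f] f(1) T(2)[OF that]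
      by auto
    have inth: "integrable M h" unfolding h_def using fT by auto
    have h: "(\<integral>x. h x \<partial>M) = (\<integral>x. f x \<partial>M)"
      using N by (simp add: h_def fT Bochner_Integration.integral_sum N_def[symmetric])
    have h0: "0 \<le> h x" for x using f(3) N by (auto simp: h_def intro!: divide_nonneg_nonneg sum_nonneg)
    have [measurable]: "h \<in> borel_measurable M" using inth by auto
    define B where "B = {x \<in> space M. \<epsilon> / 8 \<le> h x}"
    have B: "B \<in> sets M" unfolding B_def by measurable
    have "measure M B \<le> (\<integral>x. h x \<partial>M) / (\<epsilon> / 8)"
      unfolding B_def using assms h0 inth
      by (intro integral_Markov_inequality_measure[where A = "{}"]) auto
    also have "\<dots> < (\<epsilon>\<^sup>2 / 16) / (\<epsilon> / 8)"
      unfolding h using f(2) assms by (intro divide_strict_right_mono) auto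
    also have "\<dots> = \<epsilon> / 2" using assms by (simp add: power2_eq_square)
    finally have mB: "measure M B < \<epsilon> / 2" .
    have "2 / \<epsilon> \<le> real k" using k by (simp add: k0_def)
    then have "1 / (real k + 1) \<le> \<epsilon> / 2" using assms by (simp add: field_simps)
    define C where "C i = (if i = 0 then A 0 \<union> B else A i - B)" for i
    show "eps_cover M (average \<beta> E \<rho>) \<epsilon> r"
      unfolding eps_cover_def
    proof (intro exI[of _ C] conjI)
      show "\<forall>i\<le>r. C i \<in> sets M" using A(1) B by (auto simp: C_def)
      have "C i \<subseteq> space M" if "i \<le> r" for i using A B sp by auto
      moreover have "x \<in> (\<Union>i\<le>r. C i)" if "x \<in> space M" for x
      proof -
        have "x \<in> (\<Union>i\<le>r. A i)" using that unfolding A(2) .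
        then obtain i where i: "i \<le> r" "x \<in> A i" by (elim UN_E) simp
        then have "x \<in> C i \<or> x \<in> C 0" by (auto simp: C_def)
        then show ?thesis using i by blast
      qed
      ultimately show "space M = (\<Union>i\<le>r. C i)" by blast
      have "measure M (C 0) \<le> measure M (A 0) + measure M B"
        unfolding C_def using A(1) B by (simp add: measure_Un_le)
      then show "measure M (C 0) < \<epsilon>"
        using A(3) mB \<open>1 / (real k + 1) \<le> \<epsilon> / 2\<close> by linarith
      show "\<forall>i\<in>{1..r}. diam (average \<beta> E \<rho>) (C i) < ennreal \<epsilon>"
      proof
        fix i assume i: "i \<in> {1..r}"
        \<comment> \<open>The diameter is a supremum and has to be strictly below
          \<open>\<epsilon>\<close>, hence the smaller bound.\<close>
        have "average \<beta> E \<rho> x y \<le> \<epsilon> / 2" if xy: "x \<in> C i" "y \<in> C i" for x y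
        proof -
          have xy': "x \<in> A i" "y \<in> A i" "h x < \<epsilon> / 8" "h y < \<epsilon> / 8"
            using xy i sp by (auto simp: C_def B_def)
          have "(\<Sum>g\<in>E. \<rho> (act \<beta> g x) (act \<beta> g y))
              \<le> (\<Sum>g\<in>E. \<epsilon> / 4 + f (act \<beta> g x) + f (act \<beta> g y))"
          proof (intro sum_mono f(4))
            fix g assume "g \<in> E"
            then have "agree U k (act \<beta> g x) (act \<beta> g y)" using A(4) i xy' by blast
            then show "agree U k1 (act \<beta> g x) (act \<beta> g y)"
              by (rule agree_mono) (use k in \<open>simp add: k0_def\<close>)
          qed
          then have "average \<beta> E \<rho> x y \<le> (\<Sum>g\<in>E. \<epsilon> / 4 + f (act \<beta> g x) + f (act \<beta> g y)) / N"
            unfolding average_def N_def by (intro divide_right_mono) auto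
          also have "\<dots> = \<epsilon> / 4 + h x + h y"
            using N by (simp add: h_def sum.distrib add_divide_distrib N_def)
          finally show ?thesis using xy' by linarith
        qed
        then have "diam (average \<beta> E \<rho>) (C i) \<le> ennreal (\<epsilon> / 2)"
          unfolding diam_def by (intro SUP_least) (auto intro: ennreal_leI)
        also have "\<dots> < ennreal \<epsilon>" using assms by (intro ennreal_lessI) auto
        finally show "diam (average \<beta> E \<rho>) (C i) < ennreal \<epsilon>" .
      qed
    qed
  qed
qed

lemma eps_cover_imp_entropy_le:
  assumes "eps_cover M \<rho> \<epsilon> r" "0 < r"
  shows "0 \<le> real_of_ereal (eps_entropy M \<rho> \<epsilon>)" "real_of_ereal (eps_entropy M \<rho> \<epsilon>) \<le> log 2 (real r)"
proof -
  let ?Q = "\<lambda>k. k > 0 \<and> eps_cover M \<rho> \<epsilon> k"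
  have "?Q (LEAST k. ?Q k)" "(LEAST k. ?Q k) \<le> r"
    using assms LeastI[of ?Q r] Least_le[of ?Q r] by auto
  then show "0 \<le> real_of_ereal (eps_entropy M \<rho> \<epsilon>)" "real_of_ereal (eps_entropy M \<rho> \<epsilon>) \<le> log 2 (real r)"
    using assms by (auto simp: eps_entropy_def)
qed

section \<open>Density and openness in the space of actions\<close>

lemma prob_sym_diff_cong:
  assumes "finite_measure M" "R \<in> M \<rightarrow>\<^sub>M M" "R' \<in> M \<rightarrow>\<^sub>M M" "AE x in M. R x = R' x" "A \<in> sets M" "B \<in> sets M"
  shows "measure M (sym_diff (R -` A \<inter> space M) B) = measure M (sym_diff (R' -` A \<inter> space M) B)"
proof -
  interpret finite_measure M by fact
  have [measurable]: "R -` A \<inter> space M \<in> sets M" "R' -` A \<inter> space M \<in> sets M" "B \<in> sets M"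
    using assms by (auto intro: measurable_sets)
  show ?thesis
  proof (rule finite_measure_eq_AE)
    show "AE x in M. x \<in> sym_diff (R -` A \<inter> space M) B \<longleftrightarrow> x \<in> sym_diff (R' -` A \<inter> space M) B"
      using assms(4) by eventually_elim simp
  qed auto
qed

lemma measure_sym_diff_triangle:
  assumes "finite_measure M" "A \<in> sets M" "B \<in> sets M" "C \<in> sets M"
  shows "measure M (sym_diff A C) \<le> measure M (sym_diff A B) + measure M (sym_diff B C)"
proof -
  interpret finite_measure M by fact
  have "measure M (sym_diff A C) \<le> measure M (sym_diff A B \<union> sym_diff B C)"
    using assms by (intro finite_measure_mono) auto
  also have "\<dots> \<le> measure M (sym_diff A B) + measure M (sym_diff B C)"
    using assms by (intro measure_Un_le) auto
  finally show ?thesis .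
qed

text \<open>The generating set given by \<open>A = {}\<close> is already the entire carrier.\<close>

lemma topspace_weak_topology: "topspace (weak_topology M) = carrier (Aut M)"
proof -
  have "id \<in> invertible_mpt M"
    by (rule invertible_mptI[of _ _ id]) (auto simp: id_def distr_id2)
  moreover have "c \<in> carrier (Aut M) \<Longrightarrow> \<exists>T. T \<in> c" for c by (rule Aut_carrier_nonempty)
  ultimately show ?thesis
    unfolding weak_topology_def topology_generated_by_topspace
    by (auto intro!: exI[of _ id] exI[of _ "{}"] exI[of _ "1::real"] exI[of _ "carrier (Aut M)"])
qed

lemma topspace_action_topology: "topspace (action_topology G M) = actions G M"
  by (auto simp: action_topology_def topspace_weak_topology topspace_subtopology actions_def hom_def
      PiE_def Pi_def)

lemma openin_action_topology_basic:
  assumes "g \<in> carrier G" "S \<in> invertible_mpt M" "A \<in> sets M" "0 < e"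
  shows "openin (action_topology G M)
    {\<beta> \<in> actions G M. \<exists>T\<in>\<beta> g. measure M (sym_diff (T -` A \<inter> space M) (S -` A \<inter> space M)) < e}"
proof -
  let ?W = "{c \<in> carrier (Aut M). \<exists>T\<in>c. measure M (sym_diff (T -` A \<inter> space M) (S -` A \<inter> space M)) < e}"
  let ?P = "product_topology (\<lambda>_. weak_topology M) (carrier G)"
  have "openin (weak_topology M) ?W"
    unfolding weak_topology_def by (rule topology_generated_by_Basis) (use assms in blast)
  with assms(1) have "openin ?P {x \<in> topspace ?P. x g \<in> ?W}"
    by (intro openin_continuous_map_preimage[OF continuous_map_product_projection]) auto
  then have "openin (action_topology G M) ({x \<in> topspace ?P. x g \<in> ?W} \<inter> actions G M)"
    unfolding action_topology_def by (rule openin_subtopology_Int)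
  also have "{x \<in> topspace ?P. x g \<in> ?W} \<inter> actions G M =
     {\<beta> \<in> actions G M. \<exists>T\<in>\<beta> g. measure M (sym_diff (T -` A \<inter> space M) (S -` A \<inter> space M)) < e}"
    using assms(1) by (auto simp: topspace_weak_topology actions_def hom_def PiE_def Pi_def)
  finally show ?thesis .
qed

text \<open>Subbasic sets are centred at arbitrary maps; the triangle inequality recentres them at
  \<open>T\<close> with a smaller radius. Intersections take the union of the families and the
  smaller radius.\<close>

lemma weak_topology_neighbourhood:
  assumes "finite_measure M" and "openin (weak_topology M) W" and "c \<in> W" "T \<in> c"
  shows "\<exists>\<A> e. finite \<A> \<and> \<A> \<subseteq> sets M \<and> 0 < e \<and>
    (\<forall>c'\<in>carrier (Aut M). (\<forall>A\<in>\<A>. \<exists>R\<in>c'. measure M (sym_diff (R -` A \<inter> space M) (T -` A \<inter> space M)) < e)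
       \<longrightarrow> c' \<in> W)"
proof -
  let ?d = "\<lambda>R T A. measure M (sym_diff (R -` A \<inter> space M) (T -` A \<inter> space M))"
  let ?nbh = "\<lambda>W \<A> e. \<forall>c'\<in>carrier (Aut M). (\<forall>A\<in>\<A>. \<exists>R\<in>c'. ?d R T A < e) \<longrightarrow> c' \<in> W"
  have "generate_topology_on {{c \<in> carrier (Aut M). \<exists>T\<in>c. ?d T S A < e} | S A e.
       S \<in> invertible_mpt M \<and> A \<in> sets M \<and> (0::real) < e} W"
    using assms(2) unfolding weak_topology_def by (rule openin_topology_generated_by)
  then have "\<exists>\<A> e. finite \<A> \<and> \<A> \<subseteq> sets M \<and> 0 < e \<and> ?nbh W \<A> e" using assms(3)
  proof induction
    case Empty
    then show ?case by simp
  next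
    case (Int a b)
    obtain \<A> e where A: "finite \<A>" "\<A> \<subseteq> sets M" "0 < (e::real)" "?nbh a \<A> e"
      using Int.IH(1)[OF IntD1[OF Int.prems]] by (elim exE conjE)
    obtain \<B> d where B: "finite \<B>" "\<B> \<subseteq> sets M" "0 < (d::real)" "?nbh b \<B> d"
      using Int.IH(2)[OF IntD2[OF Int.prems]] by (elim exE conjE)
    show ?case
    proof (intro exI conjI)
      show "?nbh (a \<inter> b) (\<A> \<union> \<B>) (min e d)"
      proof (intro ballI impI IntI)
        fix c' assume c': "c' \<in> carrier (Aut M)" and "\<forall>A\<in>\<A> \<union> \<B>. \<exists>R\<in>c'. ?d R T A < min e d"
        then have "\<forall>A\<in>\<A>. \<exists>R\<in>c'. ?d R T A < e" "\<forall>A\<in>\<B>. \<exists>R\<in>c'. ?d R T A < d"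
          by (meson UnCI min_less_iff_conj)+
        then show "c' \<in> a" "c' \<in> b" using A(4) B(4) c' by blast+
      qed
    qed (use A B in auto)
  next
    case (UN K)
    then obtain k where "k \<in> K" "c \<in> k" by blast
    with UN.IH[of k] obtain \<A> e where A: "finite \<A>" "\<A> \<subseteq> sets M" "0 < (e::real)" "?nbh k \<A> e" by blast
    have "?nbh (\<Union>K) \<A> e" using A(4) \<open>k \<in> K\<close> by (meson UnionI)
    with A show ?case by blast
  next
    case (Basis s)
    then obtain S A e where s: "s = {c \<in> carrier (Aut M). \<exists>T\<in>c. ?d T S A < e}"
      and S: "S \<in> invertible_mpt M" and A: "A \<in> sets M" and "(0::real) < e" by blast
    obtain R0 where R0: "R0 \<in> c" "?d R0 S A < e" and c: "c \<in> carrier (Aut M)"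
      using Basis.prems s by blast
    have inv: "R0 \<in> invertible_mpt M" "T \<in> invertible_mpt M"
      using Aut_carrierD(1)[OF c] R0(1) assms(4) by blast+
    have "AE x in M. R0 x = T x"
      using Aut_carrierD(2)[OF c R0(1)] assms(4) by (auto simp: ae_equal_def)
    note meas = invertible_mptD(1)[OF inv(1)] invertible_mptD(1)[OF inv(2)] invertible_mptD(1)[OF S]
    have dT: "?d T S A < e"
      using prob_sym_diff_cong[OF assms(1) meas(1,2) \<open>AE x in M. R0 x = T x\<close> A measurable_sets[OF meas(3) A]] R0(2)
      by simp
    have "?nbh s {A} (e - ?d T S A)"
    proof (intro ballI impI)
      fix c' assume c': "c' \<in> carrier (Aut M)" and "\<forall>A'\<in>{A}. \<exists>R\<in>c'. ?d R T A' < e - ?d T S A"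
      then obtain R where R: "R \<in> c'" "?d R T A < e - ?d T S A" by blast
      have "R \<in> M \<rightarrow>\<^sub>M M" by (rule invertible_mptD(1)[OF Aut_carrierD(1)[OF c' R(1)]])
      then have "?d R S A \<le> ?d R T A + ?d T S A"
        using A meas by (intro measure_sym_diff_triangle assms(1)) (auto intro: measurable_sets)
      then show "c' \<in> s" using R c' by (auto simp: s intro!: bexI[of _ R])
    qed
    with dT A show ?case by (intro exI[of _ "{A}"] exI[of _ "e - ?d T S A"]) auto
  qed
  then show ?thesis .
qed

text \<open>A basic neighbourhood in the product restricts finitely many coordinates, so their
  families and radii can be merged into one.\<close>

lemma action_topology_neighbourhood:
  assumes "finite_measure M" and "openin (action_topology G M) W" and "\<alpha> \<in> W"
  obtains S \<A> e where "finite S" "S \<subseteq> carrier G" "finite \<A>" "\<A> \<subseteq> sets M" "0 < e"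
    "\<And>\<beta>. \<beta> \<in> actions G M \<Longrightarrow> (\<And>g A. g \<in> S \<Longrightarrow> A \<in> \<A> \<Longrightarrow>
        \<exists>R\<in>\<beta> g. measure M (sym_diff (R -` A \<inter> space M) (act \<alpha> g -` A \<inter> space M)) < e) \<Longrightarrow> \<beta> \<in> W"
proof -
  let ?P = "product_topology (\<lambda>_. weak_topology M) (carrier G)"
  let ?d = "\<lambda>R T A. measure M (sym_diff (R -` A \<inter> space M) (T -` A \<inter> space M))"
  obtain V where V: "openin ?P V" "W = V \<inter> actions G M"
    using assms(2) unfolding action_topology_def openin_subtopology by blast
  then have \<alpha>: "\<alpha> \<in> V" "\<alpha> \<in> actions G M" using assms(3) by auto
  obtain U where U: "finite {g \<in> carrier G. U g \<noteq> topspace (weak_topology M)}"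
      "\<forall>g\<in>carrier G. openin (weak_topology M) (U g)" "\<alpha> \<in> Pi\<^sub>E (carrier G) U" "Pi\<^sub>E (carrier G) U \<subseteq> V"
    using V(1)[unfolded openin_product_topology_alt, rule_format, OF \<alpha>(1)] by (elim exE conjE)
  define S where "S = {g \<in> carrier G. U g \<noteq> topspace (weak_topology M)}"
  have "\<forall>g\<in>S. \<exists>\<A> e. finite \<A> \<and> \<A> \<subseteq> sets M \<and> 0 < e \<and>
    (\<forall>c'\<in>carrier (Aut M). (\<forall>A\<in>\<A>. \<exists>R\<in>c'. ?d R (act \<alpha> g) A < e) \<longrightarrow> c' \<in> U g)"
  proof
    fix g assume "g \<in> S"
    then have g: "g \<in> carrier G" by (simp add: S_def)
    show "\<exists>\<A> e. finite \<A> \<and> \<A> \<subseteq> sets M \<and> 0 < e \<and>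
      (\<forall>c'\<in>carrier (Aut M). (\<forall>A\<in>\<A>. \<exists>R\<in>c'. ?d R (act \<alpha> g) A < e) \<longrightarrow> c' \<in> U g)"
      by (rule weak_topology_neighbourhood[OF assms(1) bspec[OF U(2) g] PiE_mem[OF U(3) g] act_mem[OF \<alpha>(2) g]])
  qed
  then obtain \<A> e where A: "\<And>g. g \<in> S \<Longrightarrow> finite (\<A> g)" "\<And>g. g \<in> S \<Longrightarrow> \<A> g \<subseteq> sets M"
    "\<And>g. g \<in> S \<Longrightarrow> (0::real) < e g"
    "\<And>g c'. g \<in> S \<Longrightarrow> c' \<in> carrier (Aut M) \<Longrightarrow> (\<forall>A\<in>\<A> g. \<exists>R\<in>c'. ?d R (act \<alpha> g) A < e g) \<Longrightarrow> c' \<in> U g"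
    by metis
  have finS: "finite S" using U(1) by (simp add: S_def)
  define e0 where "e0 = Min (insert 1 (e ` S))"
  show ?thesis
  proof (rule that[of S "\<Union>g\<in>S. \<A> g" e0])
    show "finite S" "S \<subseteq> carrier G" "finite (\<Union>g\<in>S. \<A> g)" "(\<Union>g\<in>S. \<A> g) \<subseteq> sets M"
      using finS A by (auto simp: S_def)
    show "0 < e0" using finS A(3) by (auto simp: e0_def)
    fix \<beta> assume \<beta>: "\<beta> \<in> actions G M"
      and near: "\<And>g A. g \<in> S \<Longrightarrow> A \<in> (\<Union>g\<in>S. \<A> g) \<Longrightarrow> \<exists>R\<in>\<beta> g. ?d R (act \<alpha> g) A < e0"
    have \<beta>c: "\<beta> g \<in> carrier (Aut M)" if "g \<in> carrier G" for g
      using \<beta> that by (auto simp: actions_def hom_def)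
    have "\<beta> g \<in> U g" if g: "g \<in> carrier G" for g
    proof (cases "g \<in> S")
      case True
      have "e0 \<le> e g" using finS True by (auto simp: e0_def intro: Min_le)
      then have "\<forall>A\<in>\<A> g. \<exists>R\<in>\<beta> g. ?d R (act \<alpha> g) A < e g"
        using near[OF True] True by (meson UN_I less_le_trans)
      then show ?thesis using A(4)[OF True \<beta>c[OF g]] by blast
    next
      case False
      then show ?thesis using g \<beta>c[OF g] by (simp add: S_def topspace_weak_topology)
    qed
    moreover have "\<beta> \<in> extensional (carrier G)" using \<beta> by (simp add: actions_def)
    ultimately have "\<beta> \<in> Pi\<^sub>E (carrier G) U" by (simp add: PiE_def)
    then show "\<beta> \<in> W" using U(4) V(2) \<beta> by blast
  qed
qed

section \<open>Actions with finite image\<close>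

lemma finite_image_actions_dense:
  fixes G :: "('g, 'r) monoid_scheme" and M :: "'a::polish_space measure"
  assumes "group G" "residually_finite G" "folner_sequence G F" "lebesgue_space M"
  shows "action_topology G M closure_of {\<beta> \<in> actions G M. finite (\<beta> ` carrier G)} = topspace (action_topology G M)"
proof -
  interpret prob_space M using assms by (simp add: lebesgue_space_def)
  have "\<exists>\<beta>. \<beta> \<in> {\<beta> \<in> actions G M. finite (\<beta> ` carrier G)} \<and> \<beta> \<in> W"
    if W: "\<alpha> \<in> W" "openin (action_topology G M) W" for \<alpha> W
  proof -
    have \<alpha>: "\<alpha> \<in> actions G M"
      using openin_subset[OF W(2)] W(1) by (auto simp: topspace_action_topology)
    obtain S \<A> e where S: "finite S" "S \<subseteq> carrier G" "finite \<A>" "\<A> \<subseteq> sets M" "0 < e" and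
      nbh: "\<And>\<beta>. \<beta> \<in> actions G M \<Longrightarrow> (\<And>g A. g \<in> S \<Longrightarrow> A \<in> \<A> \<Longrightarrow>
        \<exists>R\<in>\<beta> g. measure M (sym_diff (R -` A \<inter> space M) (act \<alpha> g -` A \<inter> space M)) < e) \<Longrightarrow> \<beta> \<in> W"
      using action_topology_neighbourhood[OF finite_measure_axioms W(2,1)] by metis
    show ?thesis
      by (rule finite_image_actions_approximate[OF assms \<alpha> S]) (use nbh in blast)
  qed
  then show ?thesis
    unfolding topspace_action_topology[symmetric]
    by (intro Set.set_eqI) (auto simp: in_closure_of topspace_action_topology)
qed

text \<open>The number \<open>r\<close> of patterns depends on \<open>k\<close> and on the finitely
  many maps of \<open>\<alpha>\<close>, not on \<open>n\<close>, so \<open>\<phi> n\<close> exceeds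
  its logarithm for late \<open>n\<close>. With \<open>n\<close> fixed, only the finitely many pairs
  in \<open>F n \<times> {..<k}\<close> matter, and in a small neighbourhood the corresponding
  preimages change little.\<close>

lemma finite_image_agreement_cover_open:
  fixes G :: "('g, 'r) monoid_scheme" and M :: "'a measure"
  assumes "finite_measure M" and U: "\<And>j. U j \<in> sets M"
    and \<alpha>: "\<alpha> \<in> actions G M" "finite (\<alpha> ` carrier G)"
    and F: "\<And>n. F n \<subseteq> carrier G" "\<And>n. finite (F n)"
    and \<phi>: "filterlim \<phi> at_top sequentially"
  shows "\<exists>n\<ge>k. \<exists>r>0. log 2 (real r) \<le> \<phi> n \<and> (\<exists>V. openin (action_topology G M) V \<and> \<alpha> \<in> V \<and>
    (\<forall>\<beta>\<in>V. agreement_cover M U \<beta> (F n) k r))"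
proof -
  interpret finite_measure M by fact
  let ?d = "\<lambda>R T A. measure M (sym_diff (R -` A \<inter> space M) (T -` A \<inter> space M))"
  define \<T> where "\<T> = act \<alpha> ` carrier G"
  \<comment> \<open>\<open>act\<close> picks its representative from the class alone, so finitely
    many classes give finitely many maps.\<close>
  have "\<T> = (\<lambda>c. SOME T. T \<in> c) ` \<alpha> ` carrier G" by (auto simp: \<T>_def act_def image_image)
  then have fin\<T>: "finite \<T>" using \<alpha>(2) by simp
  have \<T>M: "T \<in> M \<rightarrow>\<^sub>M M" if "T \<in> \<T>" for T
    using that invertible_mptD(1)[OF act_invertible[OF \<alpha>(1)]] by (auto simp: \<T>_def)
  define Q where "Q = \<T> \<times> {..<k}"
  have finQ: "finite Q" using fin\<T> by (simp add: Q_def)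
  define p where "p x = {q \<in> Q. fst q x \<in> U (snd q)}" for x
  define r where "r = card (Pow Q)"
  have r: "0 < r" using finQ by (simp add: r_def card_Pow)
  \<comment> \<open>Numbering starts at 1, since index 0 is reserved for the exceptional
    set.\<close>
  obtain h where h: "bij_betw h {1..r} (Pow Q)"
    using ex_bij_betw_nat_finite_1[of "Pow Q"] finQ by (auto simp: r_def)
  have "\<forall>\<^sub>F n in sequentially. log 2 (real r) \<le> \<phi> n" using \<phi> by (simp add: filterlim_at_top)
  then have "\<forall>\<^sub>F n in sequentially. log 2 (real r) \<le> \<phi> n \<and> k \<le> n"
    using eventually_ge_at_top[of k] by eventually_elim simp
  then obtain n where n: "log 2 (real r) \<le> \<phi> n" "k \<le> n"
    using eventually_happens'[OF sequentially_bot] by blast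
  \<comment> \<open>The \<open>card (F n) * k\<close> exceptional sets of measure at most
    \<open>e\<close> must add up to less than \<open>1 / (real k + 1)\<close>; the second added 1
    makes this strict and keeps the denominator positive.\<close>
  define e where "e = 1 / ((real k + 1) * (real (card (F n) * k) + 1))"
  have e: "0 < e" by (auto simp: e_def intro!: mult_pos_pos add_nonneg_pos)
  \<comment> \<open>The outer intersection keeps \<open>V\<close> inside the space even for
    \<open>k = 0\<close>, when the family of conditions is empty.\<close>
  define V where "V = actions G M \<inter>
     (\<Inter>(g, j)\<in>F n \<times> {..<k}. {\<beta> \<in> actions G M. \<exists>R\<in>\<beta> g. ?d R (act \<alpha> g) (U j) < e})"
  have "openin (action_topology G M) V"
  proof -
    have "openin (action_topology G M) (topspace (action_topology G M) \<inter>
       \<Inter>((\<lambda>(g, j). {\<beta> \<in> actions G M. \<exists>R\<in>\<beta> g. ?d R (act \<alpha> g) (U j) < e}) ` (F n \<times> {..<k})))"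
      by (rule openin_Int_Inter)
         (use F U e \<alpha>(1) in \<open>auto intro!: openin_action_topology_basic act_invertible\<close>)
    then show ?thesis by (simp add: V_def topspace_action_topology)
  qed
  moreover have "\<alpha> \<in> V"
    unfolding V_def using \<alpha>(1) e act_mem[OF \<alpha>(1)] F(1)[of n]
    by (auto intro!: bexI[of _ "act \<alpha> _"])
  moreover have "agreement_cover M U \<beta> (F n) k r" if \<beta>V: "\<beta> \<in> V" for \<beta>
  proof -
    have \<beta>: "\<beta> \<in> actions G M" using \<beta>V by (simp add: V_def)
    define E where "E = (\<lambda>(g, j). sym_diff (act \<beta> g -` U j \<inter> space M) (act \<alpha> g -` U j \<inter> space M))"
    have meas: "act \<beta> g \<in> M \<rightarrow>\<^sub>M M" "act \<alpha> g \<in> M \<rightarrow>\<^sub>M M" if "g \<in> F n" for g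
      using that F(1) \<alpha>(1) \<beta> by (auto intro: invertible_mptD(1) act_invertible)
    have ES: "E q \<in> sets M" if "q \<in> F n \<times> {..<k}" for q
      using that meas U by (auto simp: E_def intro: measurable_sets)
    have Ee: "measure M (E q) \<le> e" if q: "q \<in> F n \<times> {..<k}" for q
    proof -
      obtain g j where gj: "q = (g, j)" "g \<in> F n" "j < k" using q by auto
      then have "\<beta> \<in> {\<beta> \<in> actions G M. \<exists>R\<in>\<beta> g. ?d R (act \<alpha> g) (U j) < e}"
        using \<beta>V unfolding V_def by blast
      then obtain R where R: "R \<in> \<beta> g" "?d R (act \<alpha> g) (U j) < e" by blast
      have g: "g \<in> carrier G" using gj F by auto
      have "AE x in M. act \<beta> g x = R x" "R \<in> invertible_mpt M"
        using R(1) ae_class_act[OF \<beta> g] by (auto simp: ae_equal_def)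
      then show ?thesis
        using prob_sym_diff_cong[OF assms(1) meas(1)[OF gj(2)] invertible_mptD(1), of R "U j" "act \<alpha> g -` U j \<inter> space M"] R(2)
          U measurable_sets[OF meas(2)[OF gj(2)] U]
        by (simp add: E_def gj)
    qed
    define B where "B = (\<Union>q\<in>F n \<times> {..<k}. E q)"
    have BM: "B \<in> sets M" unfolding B_def using ES F by (intro sets.finite_UN) auto
    define A where "A i = (if i = 0 then B else {x \<in> space M. p x = h i} - B)" for i
    show ?thesis
      unfolding agreement_cover_def
    proof (intro exI[of _ A] conjI)
      have "{x \<in> space M. p x = P} \<in> sets M" if "P \<subseteq> Q" for P
      proof -
        have "{x \<in> space M. p x = P} = {x \<in> space M. \<forall>q\<in>Q. (fst q x \<in> U (snd q)) \<longleftrightarrow> q \<in> P}"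
          using that unfolding p_def by blast
        also have "\<dots> \<in> sets M"
        proof (rule sets.sets_Collect_finite_All[OF _ finQ])
          fix q assume "q \<in> Q"
          then have [measurable]: "fst q \<in> M \<rightarrow>\<^sub>M M" "U (snd q) \<in> sets M"
            using \<T>M U by (auto simp: Q_def)
          show "{x \<in> space M. (fst q x \<in> U (snd q)) \<longleftrightarrow> q \<in> P} \<in> sets M" by measurable
        qed
        finally show ?thesis .
      qed
      then show "\<forall>i\<le>r. A i \<in> sets M"
        using BM bij_betwE[OF h] by (auto simp: A_def Suc_le_eq)
      show "space M = (\<Union>i\<le>r. A i)"
      proof
        show "space M \<subseteq> (\<Union>i\<le>r. A i)"
        proof
          fix x assume x: "x \<in> space M"
          have "p x \<in> h ` {1..r}" using bij_betw_imp_surj_on[OF h] by (auto simp: p_def)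
          then obtain i where "i \<in> {1..r}" "p x = h i" by auto
          then have "x \<in> A i \<or> x \<in> A 0" "i \<le> r" using x by (auto simp: A_def)
          then show "x \<in> (\<Union>i\<le>r. A i)" by blast
        qed
        show "(\<Union>i\<le>r. A i) \<subseteq> space M"
          using sets.sets_into_space[OF BM] by (auto simp: A_def split: if_splits)
      qed
      have "measure M B \<le> (\<Sum>q\<in>F n \<times> {..<k}. measure M (E q))"
        unfolding B_def using ES F by (intro measure_UNION_le) auto
      also have "\<dots> \<le> (\<Sum>q\<in>F n \<times> {..<k}. e)" by (intro sum_mono Ee)
      also have "\<dots> = real (card (F n) * k) * e" by (simp add: card_cartesian_product)
      also have "\<dots> < (real (card (F n) * k) + 1) * e" using e by (intro mult_strict_right_mono) auto
      also have "\<dots> = 1 / (real k + 1)"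
        unfolding e_def using of_nat_0_le_iff[of "card (F n) * k", where 'a = real]
        by (simp add: divide_simps del: of_nat_mult)
      finally show "measure M (A 0) < 1 / (real k + 1)" by (simp add: A_def)
      show "\<forall>i\<in>{1..r}. \<forall>x\<in>A i. \<forall>y\<in>A i. \<forall>g\<in>F n. agree U k (act \<beta> g x) (act \<beta> g y)"
      proof (intro ballI)
        fix i x y g assume i: "i \<in> {1..r}" and xy: "x \<in> A i" "y \<in> A i" and g: "g \<in> F n"
        \<comment> \<open>Off \<open>B\<close> the perturbed map hits \<open>U j\<close> exactly
          when the original one does, and the pattern \<open>h i\<close> decides the latter.\<close>
        have eq: "act \<beta> g z \<in> U j \<longleftrightarrow> (act \<alpha> g, j) \<in> h i" if z: "z \<in> A i" "j < k" for z j
        proof -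
          have zi: "z \<in> space M" "p z = h i" "z \<notin> B" using z i by (auto simp: A_def)
          then have "z \<notin> E (g, j)" using g z by (auto simp: B_def)
          then have "act \<beta> g z \<in> U j \<longleftrightarrow> act \<alpha> g z \<in> U j" using zi by (auto simp: E_def)
          moreover have "(act \<alpha> g, j) \<in> Q" using g z F(1)[of n] by (auto simp: Q_def \<T>_def)
          ultimately show ?thesis unfolding zi(2)[symmetric] by (simp add: p_def)
        qed
        show "agree U k (act \<beta> g x) (act \<beta> g y)"
          unfolding agree_def using eq xy by simp
      qed
    qed
  qed
  ultimately show ?thesis using n r by blast
qed

section \<open>The dense countable intersection of open sets\<close>

theorem theorem3:
  fixes G :: "('g, 'r) monoid_scheme"
    and F :: "nat \<Rightarrow> 'g set"
    and M :: "'a::polish_space measure"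
    and \<phi> :: "nat \<Rightarrow> real"
  assumes "group G" and "infinite (carrier G)" and "countable (carrier G)"
    and "residually_finite G" and "amenable G" and "folner_sequence G F"
    and "lebesgue_space M"
    and "filterlim \<phi> at_top sequentially"
  shows "meager_in (action_topology G M) {\<alpha> \<in> actions G M. entropy_exceeds G M F \<alpha> \<phi>}"
proof -
  interpret M: prob_space M using assms by (simp add: lebesgue_space_def)
  have sM: "sets M = sets borel" using assms by (simp add: lebesgue_space_def)
  then have sp: "space M = UNIV" by (simp add: sets_eq_imp_space_eq)
  have F: "F n \<subseteq> carrier G" "finite (F n)" "F n \<noteq> {}" for n
    using assms(6) by (auto simp: folner_sequence_def)
  obtain U :: "nat \<Rightarrow> 'a set" where "sets borel = sigma_sets UNIV (range U)"
    by (rule borel_countably_generated)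
  then have gen: "sets M = sigma_sets (space M) (range U)" by (simp add: sM sp)
  then have U: "U j \<in> sets M" for j by auto
  let ?T = "action_topology G M"
  let ?K = "{\<beta> \<in> actions G M. finite (\<beta> ` carrier G)}"
  \<comment> \<open>Both \<open>n\<close> and the fineness of the cover are tied to
    \<open>k\<close>, so being good for every \<open>k\<close> gives ever later \<open>n\<close>
    with ever finer covers.\<close>
  define good where "good k \<beta> \<longleftrightarrow> (\<exists>n\<ge>k. \<exists>r>0. log 2 (real r) \<le> \<phi> n \<and> agreement_cover M U \<beta> (F n) k r)" for k \<beta>
  \<comment> \<open>The interior of the set of good actions, so that openness is automatic.\<close>
  define W where "W k = \<Union>{V. openin ?T V \<and> (\<forall>\<beta>\<in>V. good k \<beta>)}" for k
  have Wopen: "openin ?T (W k)" for k unfolding W_def by (rule openin_Union) blast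
  have Wgood: "good k \<beta>" if "\<beta> \<in> W k" for k \<beta> using that by (auto simp: W_def)
  have KW: "?K \<subseteq> W k" for k
  proof
    fix \<alpha> assume "\<alpha> \<in> ?K"
    then have "\<exists>n\<ge>k. \<exists>r>0. log 2 (real r) \<le> \<phi> n \<and> (\<exists>V. openin ?T V \<and> \<alpha> \<in> V \<and>
        (\<forall>\<beta>\<in>V. agreement_cover M U \<beta> (F n) k r))"
      by (intro finite_image_agreement_cover_open M.finite_measure_axioms U F assms(8)) auto
    then show "\<alpha> \<in> W k" unfolding W_def good_def by blast
  qed
  define D where "D = (\<Inter>k. W k)"
  have "gdelta_in ?T D"
    unfolding D_def by (intro gdelta_in_Inter) (auto intro: open_imp_gdelta_in Wopen)
  moreover have "?T closure_of D = topspace ?T"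
  proof
    show "topspace ?T \<subseteq> ?T closure_of D"
      unfolding finite_image_actions_dense[OF assms(1,4,6,7), symmetric]
      using KW by (intro closure_of_mono) (auto simp: D_def)
  qed (rule closure_of_subset_topspace)
  moreover have "D \<subseteq> topspace ?T - {\<alpha> \<in> actions G M. entropy_exceeds G M F \<alpha> \<phi>}"
  proof
    fix \<beta> assume \<beta>D: "\<beta> \<in> D"
    then have \<beta>: "\<beta> \<in> actions G M"
      using openin_subset[OF Wopen[of 0]] by (auto simp: D_def topspace_action_topology)
    have "\<not> entropy_exceeds G M F \<beta> \<phi>"
    proof
      assume "entropy_exceeds G M F \<beta> \<phi>"
      then obtain \<Psi> where "\<Psi> \<in> scaling_entropy G M F \<beta>" and "scaling_less (\<lambda>n _. \<phi> n) \<Psi>"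
        unfolding entropy_exceeds_def by (elim bexE)
      then obtain \<rho> \<delta> where \<rho>: "\<rho> \<in> Adm M" "scaling_le \<Psi> (Phi M \<beta> F \<rho>)"
        and \<delta>: "0 < \<delta>" "\<forall>\<epsilon>>0::real. \<phi> \<in> o(\<lambda>n. \<Psi> n \<delta>)"
        by (auto simp: scaling_entropy_def scaling_less_def scaling_equiv_def)
      then obtain \<epsilon> where \<epsilon>: "0 < \<epsilon>" "(\<lambda>n. \<Psi> n \<delta>) \<in> O(\<lambda>n. Phi M \<beta> F \<rho> n \<epsilon>)"
        unfolding scaling_le_def by blast
      have "\<phi> \<in> o(\<lambda>n. \<Psi> n \<delta>)" using \<delta>(2) zero_less_one by blast
      then have "\<phi> \<in> o(\<lambda>n. Phi M \<beta> F \<rho> n \<epsilon>)" using \<epsilon>(2) by (rule landau_o.small_big_trans)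
      then have "\<forall>\<^sub>F n in sequentially. norm (\<phi> n) \<le> 1 / 2 * norm (Phi M \<beta> F \<rho> n \<epsilon>)"
        by (rule landau_o.smallD) simp
      moreover have "\<forall>\<^sub>F n in sequentially. 0 < \<phi> n"
        using assms(8) by (simp add: filterlim_at_top_dense)
      ultimately have "\<forall>\<^sub>F n in sequentially. 0 < \<phi> n \<and> \<phi> n \<le> \<bar>Phi M \<beta> F \<rho> n \<epsilon>\<bar> / 2"
        by eventually_elim auto
      \<comment> \<open>For late \<open>n\<close> the entropy is at least twice the positive number
        \<open>\<phi> n\<close> in absolute value; the covers will bound it by
        \<open>\<phi> n\<close>.\<close>
      then obtain n0 where n0: "\<And>n. n0 \<le> n \<Longrightarrow> 0 < \<phi> n \<and> \<phi> n \<le> \<bar>Phi M \<beta> F \<rho> n \<epsilon>\<bar> / 2"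
        by (auto simp: eventually_sequentially)
      obtain k0 where k0: "\<And>\<beta> (G :: ('g, 'r) monoid_scheme) E k r. \<beta> \<in> actions G M \<Longrightarrow> E \<subseteq> carrier G \<Longrightarrow>
          finite E \<Longrightarrow> E \<noteq> {} \<Longrightarrow> k0 \<le> k \<Longrightarrow> agreement_cover M U \<beta> E k r \<Longrightarrow>
          eps_cover M (average \<beta> E \<rho>) \<epsilon> r"
        using agreement_cover_imp_eps_cover[OF M.prob_space_axioms sM gen \<rho>(1) \<epsilon>(1)] by metis
      \<comment> \<open>\<open>n0\<close> and \<open>k0\<close> depend on \<open>\<rho>\<close> and
        \<open>\<epsilon>\<close>, which come after \<open>D\<close> was fixed; since
        \<open>\<beta>\<close> is good for every \<open>k\<close>, it is good for their
        maximum.\<close>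
      have "good (max n0 k0) \<beta>" using \<beta>D by (auto simp: D_def intro: Wgood)
      then obtain n r where n: "max n0 k0 \<le> n" "0 < r" "log 2 (real r) \<le> \<phi> n"
          "agreement_cover M U \<beta> (F n) (max n0 k0) r"
        unfolding good_def by blast
      have "eps_cover M (average \<beta> (F n) \<rho>) \<epsilon> r" by (rule k0[OF \<beta> F _ n(4)]) simp
      from eps_cover_imp_entropy_le[OF this n(2)] n(3)
      have "0 \<le> Phi M \<beta> F \<rho> n \<epsilon>" "Phi M \<beta> F \<rho> n \<epsilon> \<le> \<phi> n" by (auto simp: Phi_def)
      then show False using n0[of n] n(1) by auto
    qed
    then show "\<beta> \<in> topspace ?T - {\<alpha> \<in> actions G M. entropy_exceeds G M F \<alpha> \<phi>}"
      using \<beta> by (simp add: topspace_action_topology)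
  qed
  ultimately show ?thesis
    unfolding meager_in_def by (auto simp: topspace_action_topology)
qed

end
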